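(* Let $S=\prod_{i=1}^n S_i$ be a finite product of Polish spaces endowed with the product Borel sigma algebra and a product Borel probability measure $P=\prod_{i=1}^nP_i$, and let $A$ and $B$ be Borel subsets of $S$. Then the cylindrical cores $A^{(0)}$ and $B^{(0)}$ are measurable with respect to the completion $\overline P$ of $P$, and, for all proper Borel subsets $A$ and $B$ of $S$, $$\overline P(A\,\Box\,B)\le\overline P(A^{(0)})\,\overline P(B^{(0)}).$$
   Context: Notation: $[n]=\{1,\dots,n\}$, $n\ge 1$. For $K\subseteq[n]$ and $\mathbf x\in S$, the $K$-cylinder of $\mathbf x$ is $[\mathbf x]_K=\{\mathbf y\in S:y_i=x_i\ \forall i\in K\}$. The box operation is $$A\,\Box\,B=\{\mathbf x\in S:\text{there exist disjoint }K,L\subseteq[n]\text{ such that }[\mathbf x]_K\subseteq A,\ [\mathbf x]_L\subseteq B\};$$ for Borel $A,B$ in this setting it is measurable with respect to $\overline P$. The cylindrical core of $E\subseteq S$ is $$E^{(0)}=\bigcup_{(\mathbf x,K):\ \mathbf x\in S,\ K\subseteq[n],\ 0\le|K|\le n-1,\ [\mathbf x]_K\subseteq E}[\mathbf x]_K.$$ Measurability with respect to $\overline P$ means membership in the completion of the product Borel sigma algebra with respect to $P$. *)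

theory Defs
  imports "HOL-Probability.Probability"
begin

text \<open>
  The factors \<open>S_i\<close> may be different Polish spaces, so they are given as abstract topologies
  \<open>X i\<close> (\<open>i = 1, \<dots>, n\<close>) with carriers \<open>topspace (X i)\<close> in a common ambient type; the class
  \<^class>\<open>polish_space\<close> would force all of them to be the same space. As usual, Polish spaces
  are the separable completely metrizable ones.
\<close>

definition polish_topology :: "'a topology \<Rightarrow> bool" where
  "polish_topology X \<longleftrightarrow> separable_space X \<and> completely_metrizable_space X"

definition borel_sets_of :: "'a topology \<Rightarrow> 'a set set" where
  "borel_sets_of X = sigma_sets (topspace X) {U. openin X U}"

text \<open>Points of the product \<open>S\<close> are extensional functions on \<open>{1..n}\<close>.\<close>

definition cylinder :: "(nat \<Rightarrow> 'a) set \<Rightarrow> nat set \<Rightarrow> (nat \<Rightarrow> 'a) \<Rightarrow> (nat \<Rightarrow> 'a) set" where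
  "cylinder S K x = {y \<in> S. \<forall>i\<in>K. y i = x i}"

definition disjoint_box :: "nat \<Rightarrow> (nat \<Rightarrow> 'a) set \<Rightarrow> (nat \<Rightarrow> 'a) set \<Rightarrow> (nat \<Rightarrow> 'a) set \<Rightarrow> (nat \<Rightarrow> 'a) set" where
  "disjoint_box n S A B = {x \<in> S. \<exists>K L. K \<subseteq> {1..n} \<and> L \<subseteq> {1..n} \<and> K \<inter> L = {} \<and>
     cylinder S K x \<subseteq> A \<and> cylinder S L x \<subseteq> B}"

definition cyl_core :: "nat \<Rightarrow> (nat \<Rightarrow> 'a) set \<Rightarrow> (nat \<Rightarrow> 'a) set \<Rightarrow> (nat \<Rightarrow> 'a) set" where
  "cyl_core n S E = \<Union>{cylinder S K x | x K.
     x \<in> S \<and> K \<subseteq> {1..n} \<and> card K \<le> n - 1 \<and> cylinder S K x \<subseteq> E}"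

end

theory Submission
  imports Defs
begin

text \<open>
  Reimer's inequality is reduced to a counting statement on the cube of subsets of the index set: given two
  independent samples, every subset of the coordinates selects one new sample from the first two, and the
  complementary subset selects another one. Averaging over all selections, it is enough to compare, for
  fixed samples, the number of selections in the box with the number of those for which the selected point
  is in \<open>A\<close> and the complementary one in \<open>B\<close>. This is Reimer's butterfly theorem, proved by linear algebra.

  Measurability rests on the fact that \<open>{x. cylinder S K x \<subseteq> E}\<close> is the complement of the preimage of a
  projection of a Borel set. Parametrizing the remaining coordinates by the Baire space turns this projection
  into a Souslin operation over measurable sets of the coordinates in \<open>K\<close>, which preserves completed
  measurability. Up to null sets these events are therefore measurable and determined by the coordinates
  in \<open>K\<close>, which is all that Reimer's argument uses.
\<close>

section \<open>The butterfly theorem\<close>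

text \<open>The counting step is pointwise in the pair of samples, so approximating
  \<open>{x. cylinder S K x \<subseteq> E}\<close> up to null sets helps only if the approximating
  measurable set depends exactly on the coordinates in \<open>K\<close>. It is therefore found in
  the product over \<open>K\<close> alone and pulled back. It lies inside the event: shrinking is
  harmless on the right of the inequality, and on the left only a null set is lost. The cores can
  replace \<open>A\<close> and \<open>B\<close> because, for proper sets, both index sets witnessing
  a point of the box are nonempty, hence neither is full. In the linear algebra the colouring
  \<open>k x\<close> changes with the vector, so the butterfly vectors are no tensor product basis
  and their independence is not evident. Integer coefficients serve two purposes: reduction modulo
  2, where \<open>e\<^sub>1\<close> and \<open>f\<^sub>1\<close> coincide, gives independence, and
  positivity of squares turns \<open>v \<bullet> v = 0\<close> into \<open>v = 0\<close>. On the
  measurable side, induction over Borel sets needs complements, which the Souslin operation does not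
  supply; a relation and its negation are carried together.\<close>

lemma sum_Pow_prod_mem:
  fixes g :: "'i \<Rightarrow> bool \<Rightarrow> 'r :: comm_semiring_1"
  assumes "finite I"
  shows "(\<Sum>z\<in>Pow I. \<Prod>i\<in>I. g i (i \<in> z)) = (\<Prod>i\<in>I. g i True + g i False)"
  using assms
proof (induction I)
  case (insert i I)
  have eq: "(\<Prod>j\<in>I. g j (j \<in> insert i z)) = (\<Prod>j\<in>I. g j (j \<in> z))" for z
  proof (intro prod.cong refl)
    fix j assume "j \<in> I"
    then have "j \<noteq> i" using insert.hyps by auto
    then show "g j (j \<in> insert i z) = g j (j \<in> z)" by simp
  qed
  have inj: "inj_on (insert i) (Pow I)"
    using insert.hyps by (auto simp: inj_on_def)
  have "(\<Sum>z\<in>Pow (insert i I). \<Prod>j\<in>insert i I. g j (j \<in> z))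
      = (\<Sum>z\<in>Pow I. \<Prod>j\<in>insert i I. g j (j \<in> z)) + (\<Sum>z\<in>Pow I. \<Prod>j\<in>insert i I. g j (j \<in> insert i z))"
    unfolding Pow_insert using insert.hyps
    by (subst sum.union_disjoint) (auto simp: sum.reindex[OF inj])
  also have "\<dots> = (\<Sum>z\<in>Pow I. g i False * (\<Prod>j\<in>I. g j (j \<in> z)))
      + (\<Sum>z\<in>Pow I. g i True * (\<Prod>j\<in>I. g j (j \<in> z)))"
  proof (intro arg_cong2[where f="(+)"] sum.cong refl)
    fix z assume "z \<in> Pow I"
    then have "i \<notin> z" using insert.hyps by auto
    then show "(\<Prod>j\<in>insert i I. g j (j \<in> z)) = g i False * (\<Prod>j\<in>I. g j (j \<in> z))"
      using insert.hyps by simp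
    show "(\<Prod>j\<in>insert i I. g j (j \<in> insert i z)) = g i True * (\<Prod>j\<in>I. g j (j \<in> z))"
      using insert.hyps eq by (simp del: insert_iff) simp
  qed
  also have "\<dots> = (g i True + g i False) * (\<Sum>z\<in>Pow I. \<Prod>j\<in>I. g j (j \<in> z))"
    by (simp add: sum_distrib_left[symmetric] algebra_simps)
  finally show ?case
    using insert by simp
qed simp

text \<open>Gaussian elimination, one equation at a time. Cross-multiplication replaces division by
  the pivot, so the solution stays integral, as the later parity argument requires.\<close>

lemma underdetermined_system:
  fixes a :: "'x \<Rightarrow> 'z \<Rightarrow> int"
  assumes "finite Z" "finite X" "card Z < card X"
  shows "\<exists>c. (\<exists>x\<in>X. c x \<noteq> 0) \<and> (\<forall>z\<in>Z. (\<Sum>x\<in>X. c x * a x z) = 0)"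
  using assms
proof (induction Z arbitrary: X a)
  case empty
  then have "X \<noteq> {}" by auto
  then show ?case by (auto intro!: exI[of _ "\<lambda>_. 1"])
next
  case (insert z Z)
  show ?case
  proof (cases "\<forall>x\<in>X. a x z = 0")
    case True
    from insert have "card Z < card X" by simp
    from insert.IH[OF insert.prems(1) this, of a]
    obtain c where "\<exists>x\<in>X. c x \<noteq> 0" "\<forall>z\<in>Z. (\<Sum>x\<in>X. c x * a x z) = 0"
      by (elim exE conjE)
    then show ?thesis using True by (intro exI[of _ c]) simp
  next
    case False
    then obtain p where p: "p \<in> X" "a p z \<noteq> 0" by auto
    let ?X = "X - {p}" and ?a = "\<lambda>x y. a p z * a x y - a x z * a p y"
    have "card Z < card ?X" using insert p by simp
    moreover have "finite ?X" using insert.prems by simp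
    ultimately have "\<exists>c. (\<exists>x\<in>?X. c x \<noteq> 0) \<and> (\<forall>y\<in>Z. (\<Sum>x\<in>?X. c x * ?a x y) = 0)"
      using insert.IH[of ?X ?a] by simp
    then obtain c where c: "\<exists>x\<in>?X. c x \<noteq> 0" "\<forall>y\<in>Z. (\<Sum>x\<in>?X. c x * ?a x y) = 0"
      by (elim exE conjE)
    \<comment> \<open>Scaling by the pivot \<open>a p z\<close> clears denominators; the value at
      \<open>p\<close> then solves the eliminated equation \<open>z\<close>.\<close>
    define d where "d x = (if x = p then - (\<Sum>x\<in>?X. c x * a x z) else a p z * c x)" for x
    have "(\<Sum>x\<in>X. d x * a x y) = (\<Sum>x\<in>?X. c x * ?a x y)" for y
    proof -
      have "(\<Sum>x\<in>X. d x * a x y) = d p * a p y + (\<Sum>x\<in>?X. d x * a x y)"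
        using p insert.prems by (simp add: sum.remove)
      also have "(\<Sum>x\<in>?X. d x * a x y) = (\<Sum>x\<in>?X. c x * (a p z * a x y))"
        by (intro sum.cong) (auto simp: d_def)
      finally show ?thesis
        by (simp add: d_def right_diff_distrib sum_subtractf sum_distrib_right mult.assoc)
    qed
    moreover have "(\<Sum>x\<in>?X. c x * ?a x z) = 0"
      by (intro sum.neutral) (simp add: algebra_simps)
    ultimately have "\<forall>y\<in>insert z Z. (\<Sum>x\<in>X. d x * a x y) = 0"
      using c by simp
    moreover have "\<exists>x\<in>X. d x \<noteq> 0" using c p by (auto simp: d_def)
    ultimately show ?thesis by blast
  qed
qed

text \<open>
  A coordinate in \<open>k\<close> carries one of the red vectors \<open>e\<^sub>0 = (1, 0)\<close>, \<open>e\<^sub>1 = (1, 1)\<close>, any other coordinate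
  one of the yellow vectors \<open>f\<^sub>0 = (0, 1)\<close>, \<open>f\<^sub>1 = (1, -1)\<close>. They satisfy \<open>e\<^sub>b \<bullet> f\<^sub>c = of_bool (b \<noteq> c)\<close>,
  and \<open>e\<^sub>1\<close> and \<open>f\<^sub>1\<close> agree modulo 2.
\<close>

definition red_vec :: "bool \<Rightarrow> bool \<Rightarrow> int" where
  "red_vec b t = (if b \<or> \<not> t then 1 else 0)"

definition yellow_vec :: "bool \<Rightarrow> bool \<Rightarrow> int" where
  "yellow_vec b t = (if b then (if t then - 1 else 1) else (if t then 1 else 0))"

text \<open>Entry \<open>t\<close> of a tensor product of two-dimensional vectors, one per
  coordinate. Sums over all entries \<open>t\<close> therefore factor over the coordinates, by
  \<open>sum_Pow_prod_mem\<close>.\<close>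

definition butterfly_vec :: "'i set \<Rightarrow> 'i set \<Rightarrow> 'i set \<Rightarrow> 'i set \<Rightarrow> int" where
  "butterfly_vec I k x t =
    (\<Prod>i\<in>I. if i \<in> k then red_vec (i \<in> x) (i \<in> t) else yellow_vec (i \<in> x) (i \<in> t))"

text \<open>
  Summing over the two values of a coordinate kills, modulo 2, the vectors with this coordinate in \<open>x\<close> and
  removes the coordinate from the remaining ones; this isolates the coefficients of the \<open>x\<close> avoiding it.
\<close>

lemma butterfly_vec_independent_mod2:
  assumes "finite I"
    and "\<And>t. t \<subseteq> I \<Longrightarrow> even (\<Sum>x\<in>Pow I. c x * butterfly_vec I (k x) x t)"
    and "x \<subseteq> I"
  shows "even (c x)"
  using assms
proof (induction I arbitrary: c k x)
  case empty
  then show ?case by (auto simp: butterfly_vec_def)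
next
  case (insert i I)
  let ?w = "butterfly_vec I" and ?w' = "butterfly_vec (insert i I)"
  let ?u = "\<lambda>k b t. if i \<in> k then red_vec b t else yellow_vec b t"
  have inj: "inj_on (insert i) (Pow I)"
    using insert.hyps by (auto simp: inj_on_def)
  have w: "?w' k x t = ?u k (i \<in> x) (i \<in> t) * ?w k (x - {i}) (t - {i})" for k x t
  proof -
    have "(j \<in> y - {i}) = (j \<in> y)" if "j \<in> I" for j y
      using that insert.hyps by auto
    then have "(\<Prod>j\<in>I. if j \<in> k then red_vec (j \<in> x) (j \<in> t) else yellow_vec (j \<in> x) (j \<in> t)) = ?w k (x - {i}) (t - {i})"
      unfolding butterfly_vec_def by (intro prod.cong refl) (simp del: Diff_iff)
    then show ?thesis
      using insert.hyps by (simp add: butterfly_vec_def[of "insert i I"])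
  qed
  have split: "(\<Sum>x\<in>Pow (insert i I). c x * ?w' (k x) x t) =
      (\<Sum>x\<in>Pow I. c x * (?u (k x) False (i \<in> t) * ?w (k x) x (t - {i}))) +
      (\<Sum>x\<in>Pow I. c (insert i x) * (?u (k (insert i x)) True (i \<in> t) * ?w (k (insert i x)) x (t - {i})))"
    for t
  proof -
    have x: "x - {i} = x" "insert i x - {i} = x" "(i \<in> x) = False" if "x \<in> Pow I" for x
      using that insert.hyps by auto
    have "(\<Sum>x\<in>Pow (insert i I). c x * ?w' (k x) x t) = (\<Sum>x\<in>Pow I. c x * ?w' (k x) x t) +
        (\<Sum>x\<in>Pow I. c (insert i x) * ?w' (k (insert i x)) (insert i x) t)"
      unfolding Pow_insert using insert.hyps
      by (subst sum.union_disjoint) (auto simp: sum.reindex[OF inj])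
    also have "\<dots> = (\<Sum>x\<in>Pow I. c x * (?u (k x) False (i \<in> t) * ?w (k x) x (t - {i}))) +
      (\<Sum>x\<in>Pow I. c (insert i x) * (?u (k (insert i x)) True (i \<in> t) * ?w (k (insert i x)) x (t - {i})))"
      unfolding w by (intro arg_cong2[where f="(+)"] sum.cong refl) (simp_all only: x insertI1 simp_thms)
    finally show ?thesis .
  qed
  have 1: "even (\<Sum>x\<in>Pow I. c x * ?w (k x) x t)" if "t \<subseteq> I" for t
  proof -
    have t: "t - {i} = t" "(i \<in> t) = False" "insert i t - {i} = t" "(i \<in> insert i t) = True"
      using that insert.hyps by auto
    have R: "even (\<Sum>x\<in>Pow I. c (insert i x) * (?u (k (insert i x)) True False * ?w (k (insert i x)) x t)
          + c (insert i x) * (?u (k (insert i x)) True True * ?w (k (insert i x)) x t))"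
      by (intro dvd_sum) (auto simp: red_vec_def yellow_vec_def)
    have "even ((\<Sum>x\<in>Pow (insert i I). c x * ?w' (k x) x t)
        + (\<Sum>x\<in>Pow (insert i I). c x * ?w' (k x) x (insert i t)))" (is "even ?s")
      using insert.prems(1)[of t] insert.prems(1)[of "insert i t"] that by auto
    also have "?s = (\<Sum>x\<in>Pow I. c x * (?u (k x) False False * ?w (k x) x t) + c x * (?u (k x) False True * ?w (k x) x t))
        + (\<Sum>x\<in>Pow I. c (insert i x) * (?u (k (insert i x)) True False * ?w (k (insert i x)) x t)
          + c (insert i x) * (?u (k (insert i x)) True True * ?w (k (insert i x)) x t))"
      unfolding split t sum.distrib by (simp only: add_ac)
    also have "(\<Sum>x\<in>Pow I. c x * (?u (k x) False False * ?w (k x) x t) + c x * (?u (k x) False True * ?w (k x) x t))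
      = (\<Sum>x\<in>Pow I. c x * ?w (k x) x t)"
      by (intro sum.cong) (auto simp: red_vec_def yellow_vec_def)
    also have "even (\<dots> + (\<Sum>x\<in>Pow I. c (insert i x) * (?u (k (insert i x)) True False * ?w (k (insert i x)) x t)
          + c (insert i x) * (?u (k (insert i x)) True True * ?w (k (insert i x)) x t))) \<longleftrightarrow> even \<dots>"
      using R by (simp only: even_add simp_thms)
    finally show ?thesis .
  qed
  have c1: "even (c x)" if "x \<subseteq> I" for x
    using insert.IH[OF 1 that] .
  \<comment> \<open>Now only entries \<open>t\<close> without \<open>i\<close> are tested. The
    coefficients of sets without \<open>i\<close> are already even, and \<open>e\<^sub>1\<close> and
    \<open>f\<^sub>1\<close> both have entry 1 there, so the colour of \<open>i\<close> does not
    matter. The colouring left for the induction is that of \<open>insert i x\<close>, which is why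
    \<open>k\<close> is generalized.\<close>
  have 2: "even (\<Sum>x\<in>Pow I. c (insert i x) * ?w (k (insert i x)) x t)" if "t \<subseteq> I" for t
  proof -
    have t: "t - {i} = t" "(i \<in> t) = False" "insert i t - {i} = t" "(i \<in> insert i t) = True"
      using that insert.hyps by auto
    have "even (\<Sum>x\<in>Pow (insert i I). c x * ?w' (k x) x t)"
      using insert.prems(1)[of t] that by auto
    moreover have "even (\<Sum>x\<in>Pow I. c x * (?u (k x) False False * ?w (k x) x t))"
      using c1 by (intro dvd_sum) auto
    moreover have "(\<Sum>x\<in>Pow I. c (insert i x) * (?u (k (insert i x)) True False * ?w (k (insert i x)) x t))
      = (\<Sum>x\<in>Pow I. c (insert i x) * ?w (k (insert i x)) x t)"
      by (intro sum.cong) (auto simp: red_vec_def yellow_vec_def)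
    ultimately show ?thesis
      unfolding split t by simp
  qed
  have c2: "even (c (insert i x))" if "x \<subseteq> I" for x
    using insert.IH[OF 2 that] .
  show ?case
    using c1[of x] c2[of "x - {i}"] insert.prems(2)
    by (cases "i \<in> x") (auto simp: insert_absorb)
qed

text \<open>Infinite descent: all coefficients of an integral relation are even, and halving them
  gives another relation. So every power of 2 divides each coefficient.\<close>

lemma butterfly_vec_independent:
  assumes "finite I"
    and "\<And>t. t \<subseteq> I \<Longrightarrow> (\<Sum>x\<in>Pow I. c x * butterfly_vec I (k x) x t) = 0"
    and "x \<subseteq> I"
  shows "c x = 0"
proof -
  have "\<forall>x. x \<subseteq> I \<longrightarrow> 2 ^ m dvd c x" for m
    using assms(2)
  proof (induction m arbitrary: c)
    case (Suc m)
    have ev: "even (c x)" if "x \<subseteq> I" for x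
      using butterfly_vec_independent_mod2[OF assms(1) _ that, of c k] Suc.prems by simp
    have "(\<Sum>x\<in>Pow I. c x div 2 * butterfly_vec I (k x) x t) = 0" if "t \<subseteq> I" for t
    proof -
      have "2 * (\<Sum>x\<in>Pow I. c x div 2 * butterfly_vec I (k x) x t)
          = (\<Sum>x\<in>Pow I. c x * butterfly_vec I (k x) x t)"
        unfolding sum_distrib_left using ev by (intro sum.cong) auto
      then show ?thesis using Suc.prems[OF that] by simp
    qed
    from Suc.IH[OF this] ev show ?case
      by (metis dvd_div_mult_self mult.commute mult_dvd_mono dvd_refl power_Suc)
  qed simp
  then have "2 ^ (nat \<bar>c x\<bar>) dvd c x" using assms(3) by blast
  moreover have "int (nat \<bar>c x\<bar>) < int (2 ^ nat \<bar>c x\<bar>)"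
    by (simp only: of_nat_less_iff less_exp)
  then have "\<bar>c x\<bar> < \<bar>2 ^ nat \<bar>c x\<bar>\<bar>" by simp
  ultimately show ?thesis
    using dvd_imp_le_int[of "c x" "2 ^ nat \<bar>c x\<bar>"] by linarith
qed

text \<open>
  The coefficients come from \<open>f\<^sub>0 = e\<^sub>1 - e\<^sub>0\<close>, \<open>f\<^sub>1 = 2 e\<^sub>0 - e\<^sub>1\<close> and \<open>e\<^sub>0 = f\<^sub>1 + f\<^sub>0\<close>, \<open>e\<^sub>1 = f\<^sub>1 + 2 f\<^sub>0\<close>.
\<close>

definition red_coeff :: "'i set \<Rightarrow> 'i set \<Rightarrow> 'i set \<Rightarrow> 'i set \<Rightarrow> int" where
  "red_coeff I k x z = (\<Prod>i\<in>I. if i \<in> k then of_bool (i \<in> z \<longleftrightarrow> i \<in> x)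
     else if i \<in> x then (if i \<in> z then - 1 else 2) else (if i \<in> z then 1 else - 1))"

definition yellow_coeff :: "'i set \<Rightarrow> 'i set \<Rightarrow> 'i set \<Rightarrow> 'i set \<Rightarrow> int" where
  "yellow_coeff I k x z = (\<Prod>i\<in>I. if i \<in> k then (if i \<in> x \<and> i \<notin> z then 2 else 1)
     else of_bool (i \<in> z \<longleftrightarrow> i \<in> x))"

section \<open>Expansions in the red and yellow bases, and their duality\<close>

lemma butterfly_vec_red:
  assumes "finite I"
  shows "butterfly_vec I k x t = (\<Sum>z\<in>Pow I. red_coeff I k x z * (\<Prod>i\<in>I. red_vec (i \<in> z) (i \<in> t)))"
proof -
  define g where "g i b = (if i \<in> k then of_bool (b \<longleftrightarrow> i \<in> x)
     else if i \<in> x then (if b then - 1 else 2) else (if b then 1 else - 1)) * red_vec b (i \<in> t)" for i b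
  have "(\<Sum>z\<in>Pow I. red_coeff I k x z * (\<Prod>i\<in>I. red_vec (i \<in> z) (i \<in> t)))
    = (\<Sum>z\<in>Pow I. \<Prod>i\<in>I. g i (i \<in> z))"
    unfolding red_coeff_def g_def by (simp only: prod.distrib)
  also have "\<dots> = butterfly_vec I k x t"
    unfolding sum_Pow_prod_mem[OF assms] butterfly_vec_def
    by (intro prod.cong) (auto simp: g_def red_vec_def yellow_vec_def)
  finally show ?thesis ..
qed

lemma butterfly_vec_yellow:
  assumes "finite I"
  shows "butterfly_vec I k x t = (\<Sum>z\<in>Pow I. yellow_coeff I k x z * (\<Prod>i\<in>I. yellow_vec (i \<in> z) (i \<in> t)))"
proof -
  define g where "g i b = (if i \<in> k then (if i \<in> x \<and> \<not> b then 2 else 1)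
     else of_bool (b \<longleftrightarrow> i \<in> x)) * yellow_vec b (i \<in> t)" for i b
  have "(\<Sum>z\<in>Pow I. yellow_coeff I k x z * (\<Prod>i\<in>I. yellow_vec (i \<in> z) (i \<in> t)))
    = (\<Sum>z\<in>Pow I. \<Prod>i\<in>I. g i (i \<in> z))"
    unfolding yellow_coeff_def g_def by (simp only: prod.distrib)
  also have "\<dots> = butterfly_vec I k x t"
    unfolding sum_Pow_prod_mem[OF assms] butterfly_vec_def
    by (intro prod.cong) (auto simp: g_def red_vec_def yellow_vec_def)
  finally show ?thesis ..
qed

text \<open>The tensor power of
  \<open>e\<^sub>b \<bullet> f\<^sub>c = of_bool (b \<noteq> c)\<close>: the two bases are dual up
  to complementation of the index. This is the source of \<open>I - z\<close> in the butterfly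
  theorem.\<close>

lemma red_yellow_dual:
  assumes "finite I" "z \<subseteq> I" "z' \<subseteq> I"
  shows "(\<Sum>t\<in>Pow I. (\<Prod>i\<in>I. red_vec (i \<in> z) (i \<in> t)) * (\<Prod>i\<in>I. yellow_vec (i \<in> z') (i \<in> t)))
    = of_bool (z' = I - z)"
proof -
  define g where "g i b = red_vec (i \<in> z) b * yellow_vec (i \<in> z') b" for i b
  have "(\<Sum>t\<in>Pow I. (\<Prod>i\<in>I. red_vec (i \<in> z) (i \<in> t)) * (\<Prod>i\<in>I. yellow_vec (i \<in> z') (i \<in> t)))
    = (\<Sum>t\<in>Pow I. \<Prod>i\<in>I. g i (i \<in> t))"
    unfolding g_def by (simp only: prod.distrib)
  also have "\<dots> = (\<Prod>i\<in>I. of_bool (i \<in> z' \<longleftrightarrow> i \<notin> z))"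
    unfolding sum_Pow_prod_mem[OF assms(1)]
    by (intro prod.cong) (auto simp: g_def red_vec_def yellow_vec_def)
  also have "\<dots> = of_bool (\<forall>i\<in>I. i \<in> z' \<longleftrightarrow> i \<notin> z)"
    using assms(1) by (induction I) auto
  also have "(\<forall>i\<in>I. i \<in> z' \<longleftrightarrow> i \<notin> z) \<longleftrightarrow> z' = I - z"
    using assms(2,3) by auto
  finally show ?thesis .
qed

text \<open>
  If the left hand side were larger, some nontrivial combination \<open>v\<close> of the butterfly vectors of \<open>X\<close> would
  have vanishing red coordinates on the set on the right. Expanding one factor of \<open>v \<bullet> v\<close> in the red basis
  and the other one in the dual yellow basis then gives \<open>v \<bullet> v = 0\<close>.
\<close>

theorem reimer_butterfly:
  fixes I :: "'i set" and k :: "'i set \<Rightarrow> 'i set"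
  assumes "finite I" "X \<subseteq> Pow I"
  shows "card X \<le> card {z \<in> Pow I. (\<exists>x\<in>X. z \<inter> k x = x \<inter> k x) \<and> (\<exists>x\<in>X. (I - z) - k x = x - k x)}"
    (is "_ \<le> card ?Z")
proof (rule ccontr)
  assume "\<not> ?thesis"
  then have less: "card ?Z < card X" by simp
  have fin: "finite X" "finite ?Z" using assms finite_subset by auto
  from underdetermined_system[OF fin(2,1) less, of "\<lambda>x z. red_coeff I (k x) x z"]
  obtain c0 where c0: "\<exists>x\<in>X. c0 x \<noteq> 0"
    "\<And>z. z \<in> ?Z \<Longrightarrow> (\<Sum>x\<in>X. c0 x * red_coeff I (k x) x z) = 0"
    by (elim exE conjE) (rule that, assumption, drule (1) bspec)
  \<comment> \<open>Extension by zero to the whole cube, where independence of the butterfly vectors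
    is available.\<close>
  define c where "c x = (if x \<in> X then c0 x else 0)" for x
  define a where "a z = (\<Sum>x\<in>Pow I. c x * red_coeff I (k x) x z)" for z
  define b where "b z = (\<Sum>x\<in>Pow I. c x * yellow_coeff I (k x) x z)" for z
  define v where "v t = (\<Sum>x\<in>Pow I. c x * butterfly_vec I (k x) x t)" for t
  have a: "a z = (\<Sum>x\<in>X. c0 x * red_coeff I (k x) x z)" for z
    unfolding a_def using assms by (intro sum.mono_neutral_cong_right) (auto simp: c_def)
  have b: "b z = (\<Sum>x\<in>X. c0 x * yellow_coeff I (k x) x z)" for z
    unfolding b_def using assms by (intro sum.mono_neutral_cong_right) (auto simp: c_def)
  have va: "v t = (\<Sum>z\<in>Pow I. a z * (\<Prod>i\<in>I. red_vec (i \<in> z) (i \<in> t)))" for t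
    unfolding v_def a_def butterfly_vec_red[OF assms(1)] sum_distrib_left sum_distrib_right
    by (subst sum.swap) (simp add: mult.assoc)
  have vb: "v t = (\<Sum>z\<in>Pow I. b z * (\<Prod>i\<in>I. yellow_vec (i \<in> z) (i \<in> t)))" for t
    unfolding v_def b_def butterfly_vec_yellow[OF assms(1)] sum_distrib_left sum_distrib_right
    by (subst sum.swap) (simp add: mult.assoc)
  \<comment> \<open>On \<open>?Z\<close> the red coordinate vanishes by the choice of
    \<open>c0\<close>. Elsewhere one of the two agreement conditions fails for every
    \<open>x \<in> X\<close>, and then each \<open>red_coeff\<close> at \<open>z\<close>, or each
    \<open>yellow_coeff\<close> at \<open>I - z\<close>, contains a vanishing factor.\<close>
  have ab: "a z * b (I - z) = 0" if z: "z \<in> Pow I" for z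
  proof (cases "z \<in> ?Z")
    case True
    then show ?thesis using c0 a by simp
  next
    case False
    then consider "\<forall>x\<in>X. z \<inter> k x \<noteq> x \<inter> k x" | "\<forall>x\<in>X. (I - z) - k x \<noteq> x - k x"
      using z by blast
    then show ?thesis
    proof cases
      case 1
      have "red_coeff I (k x) x z = 0" if x: "x \<in> X" for x
      proof -
        obtain i where i: "i \<in> k x" "(i \<in> z) \<noteq> (i \<in> x)"
          using bspec[OF 1 x] by blast
        moreover have "i \<in> I"
          using i x z assms(2) by blast
        ultimately show ?thesis
          unfolding red_coeff_def using assms(1) by (intro prod_zero bexI[of _ i]) simp_all
      qed
      then show ?thesis by (simp add: a)
    next
      case 2
      have "yellow_coeff I (k x) x (I - z) = 0" if x: "x \<in> X" for x
      proof -
        obtain i where i: "i \<notin> k x" "(i \<in> I - z) \<noteq> (i \<in> x)"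
          using bspec[OF 2 x] by blast
        moreover have "i \<in> I"
          using i x assms(2) by blast
        ultimately show ?thesis
          unfolding yellow_coeff_def using assms(1) by (intro prod_zero bexI[of _ i]) simp_all
      qed
      then show ?thesis by (simp add: b)
    qed
  qed
  have "(\<Sum>t\<in>Pow I. v t * v t) = (\<Sum>t\<in>Pow I. \<Sum>z\<in>Pow I. \<Sum>z'\<in>Pow I.
      a z * b z' * ((\<Prod>i\<in>I. red_vec (i \<in> z) (i \<in> t)) * (\<Prod>i\<in>I. yellow_vec (i \<in> z') (i \<in> t))))"
    by (subst va, subst vb) (simp add: sum_product mult_ac)
  also have "\<dots> = (\<Sum>z\<in>Pow I. \<Sum>z'\<in>Pow I. a z * b z' * (\<Sum>t\<in>Pow I.
      (\<Prod>i\<in>I. red_vec (i \<in> z) (i \<in> t)) * (\<Prod>i\<in>I. yellow_vec (i \<in> z') (i \<in> t))))"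
    unfolding sum_distrib_left
    by (rule trans[OF sum.swap], rule sum.cong[OF refl], rule sum.swap)
  also have "\<dots> = (\<Sum>z\<in>Pow I. \<Sum>z'\<in>Pow I. a z * b z' * of_bool (z' = I - z))"
    by (intro sum.cong refl) (simp add: red_yellow_dual[OF assms(1)])
  also have "\<dots> = (\<Sum>z\<in>Pow I. a z * b (I - z))"
  proof (intro sum.cong refl)
    fix z
    have "(\<Sum>z'\<in>Pow I. a z * b z' * of_bool (z' = I - z)) = (\<Sum>z'\<in>{I - z}. a z * b z')"
      using assms(1) by (intro sum.mono_neutral_cong_right) auto
    then show "(\<Sum>z'\<in>Pow I. a z * b z' * of_bool (z' = I - z)) = a z * b (I - z)" by simp
  qed
  also have "\<dots> = 0" by (intro sum.neutral ballI) (rule ab)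
  finally have "\<forall>t\<in>Pow I. v t * v t = 0"
    using assms(1) by (subst (asm) sum_nonneg_eq_0_iff) auto
  then have "v t = 0" if "t \<subseteq> I" for t using that by auto
  then have zero: "c x = 0" if "x \<subseteq> I" for x
    using butterfly_vec_independent[OF assms(1) _ that, of c k] by (simp add: v_def)
  from c0(1) obtain x where "x \<in> X" "c0 x \<noteq> 0" by blast
  with zero[of x] assms(2) show False by (auto simp: c_def)
qed

section \<open>Reimer's inequality for product measures\<close>

definition coord_select :: "'i set \<Rightarrow> 'i set \<Rightarrow> ('i \<times> bool \<Rightarrow> 'a) \<Rightarrow> 'i \<Rightarrow> 'a" where
  "coord_select I s \<omega> = (\<lambda>i\<in>I. \<omega> (i, i \<in> s))"

text \<open>The index set \<open>J\<close> is left open because the selection is used both on the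
  full doubled product and on the half that it actually reads.\<close>

lemma distr_coord_select:
  assumes "\<And>i. i \<in> I \<Longrightarrow> prob_space (P i)" and "\<And>i. i \<in> I \<Longrightarrow> (i, i \<in> s) \<in> J" "J \<subseteq> I \<times> UNIV"
  shows "distr (PiM J (\<lambda>(i, b). P i)) (PiM I P) (coord_select I s) = PiM I P"
proof -
  have "distr (PiM J (\<lambda>(i, b). P i)) (\<Pi>\<^sub>M i\<in>I. (\<lambda>(i, b). P i) (i, i \<in> s))
      (\<lambda>\<omega>. \<lambda>i\<in>I. \<omega> (i, i \<in> s)) = (\<Pi>\<^sub>M i\<in>I. (\<lambda>(i, b). P i) (i, i \<in> s))"
    using assms by (intro distr_PiM_reindex) (auto simp: inj_on_def)
  then show ?thesis by (simp add: coord_select_def[abs_def])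
qed

lemma measurable_coord_select:
  assumes "\<And>i. i \<in> I \<Longrightarrow> (i, i \<in> s) \<in> J"
  shows "coord_select I s \<in> PiM J (\<lambda>(i, b). P i) \<rightarrow>\<^sub>M PiM I P"
  unfolding coord_select_def[abs_def]
proof (rule measurable_restrict)
  fix i assume "i \<in> I"
  then have "(\<lambda>\<omega>. \<omega> (i, i \<in> s)) \<in> PiM J (\<lambda>(i, b). P i) \<rightarrow>\<^sub>M (\<lambda>(i, b). P i) (i, i \<in> s)"
    using assms by (intro measurable_component_singleton)
  then show "(\<lambda>\<omega>. \<omega> (i, i \<in> s)) \<in> PiM J (\<lambda>(i, b). P i) \<rightarrow>\<^sub>M P i" by simp
qed

text \<open>A selection and its complement read disjoint halves \<open>J1\<close>, \<open>J2\<close>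
  of the doubled index set, so they are independent, each with the law of a single sample.\<close>

lemma measure_coord_select_complement:
  fixes P :: "'i \<Rightarrow> 'a measure"
  assumes fin: "finite I" and P: "\<And>i. prob_space (P i)" and s: "s \<subseteq> I"
    and A: "A \<in> sets (PiM I P)" and B: "B \<in> sets (PiM I P)"
  defines "\<Omega> \<equiv> PiM (I \<times> UNIV) (\<lambda>(i, b). P i)"
  shows "measure \<Omega> {\<omega> \<in> space \<Omega>. coord_select I s \<omega> \<in> A \<and> coord_select I (I - s) \<omega> \<in> B}
    = measure (PiM I P) A * measure (PiM I P) B"
proof -
  let ?Q = "\<lambda>(i, b::bool). P i"
  define J1 where "J1 = (\<lambda>i. (i, i \<in> s)) ` I"
  define J2 where "J2 = (\<lambda>i. (i, i \<in> I - s)) ` I"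
  have J: "J1 \<inter> J2 = {}" "J1 \<union> J2 = I \<times> UNIV" "finite J1" "finite J2"
    using fin by (auto simp: J1_def J2_def image_iff)
  interpret Q: product_sigma_finite ?Q
    using P by (auto simp: product_sigma_finite_def intro!: prob_space_imp_sigma_finite)
  interpret M: prob_space "PiM I P" using P by (intro prob_space_PiM)
  interpret S2: sigma_finite_measure "PiM J2 ?Q"
    using J(4) by (rule Q.sigma_finite)
  interpret O: prob_space \<Omega> unfolding \<Omega>_def using P by (intro prob_space_PiM) auto
  let ?E = "{\<omega> \<in> space \<Omega>. coord_select I s \<omega> \<in> A \<and> coord_select I (I - s) \<omega> \<in> B}"
  have m[measurable]: "coord_select I s \<in> \<Omega> \<rightarrow>\<^sub>M PiM I P" for s
    unfolding \<Omega>_def by (rule measurable_coord_select) auto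
  have E: "?E \<in> sets \<Omega>" using A B by measurable
  have m1: "coord_select I s \<in> PiM J1 ?Q \<rightarrow>\<^sub>M PiM I P"
    by (rule measurable_coord_select) (auto simp: J1_def)
  have m2: "coord_select I (I - s) \<in> PiM J2 ?Q \<rightarrow>\<^sub>M PiM I P"
    by (rule measurable_coord_select) (auto simp: J2_def)
  let ?A = "coord_select I s -` A \<inter> space (PiM J1 ?Q)"
  let ?B = "coord_select I (I - s) -` B \<inter> space (PiM J2 ?Q)"
  have sel: "coord_select I s (merge J1 J2 (u, v)) = coord_select I s u"
    "coord_select I (I - s) (merge J1 J2 (u, v)) = coord_select I (I - s) v" for u v
    using J(1) by (auto simp: coord_select_def J1_def J2_def fun_eq_iff restrict_def)
  have \<Omega>: "\<Omega> = distr (PiM J1 ?Q \<Otimes>\<^sub>M PiM J2 ?Q) \<Omega> (merge J1 J2)"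
    using Q.distr_merge[OF J(1,3,4)] by (simp add: \<Omega>_def J(2))
  have mm: "merge J1 J2 \<in> PiM J1 ?Q \<Otimes>\<^sub>M PiM J2 ?Q \<rightarrow>\<^sub>M \<Omega>"
    unfolding \<Omega>_def J(2)[symmetric] by measurable
  have pre: "merge J1 J2 -` ?E \<inter> space (PiM J1 ?Q \<Otimes>\<^sub>M PiM J2 ?Q) = ?A \<times> ?B"
    using measurable_space[OF mm] by (auto simp: sel space_pair_measure)
  have "emeasure \<Omega> ?E = emeasure (distr (PiM J1 ?Q \<Otimes>\<^sub>M PiM J2 ?Q) \<Omega> (merge J1 J2)) ?E"
    by (simp only: \<Omega>[symmetric])
  also have "\<dots> = emeasure (PiM J1 ?Q \<Otimes>\<^sub>M PiM J2 ?Q) (?A \<times> ?B)"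
    by (subst emeasure_distr[OF mm E]) (simp only: pre)
  also have "\<dots> = emeasure (PiM J1 ?Q) ?A * emeasure (PiM J2 ?Q) ?B"
    using measurable_sets[OF m1 A] measurable_sets[OF m2 B] by (rule S2.emeasure_pair_measure_Times)
  also have "emeasure (PiM J1 ?Q) ?A = emeasure (distr (PiM J1 ?Q) (PiM I P) (coord_select I s)) A"
    by (rule emeasure_distr[OF m1 A, symmetric])
  also have "distr (PiM J1 ?Q) (PiM I P) (coord_select I s) = PiM I P"
    using P by (intro distr_coord_select) (auto simp: J1_def)
  also have "emeasure (PiM J2 ?Q) ?B = emeasure (distr (PiM J2 ?Q) (PiM I P) (coord_select I (I - s))) B"
    by (rule emeasure_distr[OF m2 B, symmetric])
  also have "distr (PiM J2 ?Q) (PiM I P) (coord_select I (I - s)) = PiM I P"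
    using P by (intro distr_coord_select) (auto simp: J2_def)
  finally show ?thesis
    by (simp add: O.emeasure_eq_measure M.emeasure_eq_measure ennreal_mult[symmetric])
qed

text \<open>
  Condition on the unordered pairs
  \<open>{\<omega> (i, True), \<omega> (i, False)}\<close> of two independent samples: for every \<open>\<omega>\<close> the butterfly theorem
  compares the number of selections \<open>s\<close> which land in the left hand side with the number of those for
  which \<open>s\<close> lands in the first and the complementary selection in the second union.
\<close>

theorem reimer_PiM:
  fixes P :: "'i \<Rightarrow> 'a measure" and C D :: "'i set \<Rightarrow> ('i \<Rightarrow> 'a) set"
  assumes fin: "finite I" and P: "\<And>i. prob_space (P i)"
    and C: "\<And>K. K \<subseteq> I \<Longrightarrow> C K \<in> sets (PiM I P)"
    and D: "\<And>K. K \<subseteq> I \<Longrightarrow> D K \<in> sets (PiM I P)"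
    and Cd: "\<And>K x y. K \<subseteq> I \<Longrightarrow> x \<in> C K \<Longrightarrow> y \<in> space (PiM I P) \<Longrightarrow> (\<And>i. i \<in> K \<Longrightarrow> y i = x i) \<Longrightarrow> y \<in> C K"
    and Dd: "\<And>K x y. K \<subseteq> I \<Longrightarrow> x \<in> D K \<Longrightarrow> y \<in> space (PiM I P) \<Longrightarrow> (\<And>i. i \<in> K \<Longrightarrow> y i = x i) \<Longrightarrow> y \<in> D K"
  shows "measure (PiM I P) (\<Union>K\<in>Pow I. \<Union>L\<in>Pow (I - K). C K \<inter> D L)
    \<le> measure (PiM I P) (\<Union>K\<in>Pow I. C K) * measure (PiM I P) (\<Union>L\<in>Pow I. D L)"
proof -
  let ?M = "PiM I P"
  let ?Box = "\<Union>K\<in>Pow I. \<Union>L\<in>Pow (I - K). C K \<inter> D L"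
  let ?A = "\<Union>K\<in>Pow I. C K" and ?B = "\<Union>L\<in>Pow I. D L"
  define \<Omega> where "\<Omega> = PiM (I \<times> UNIV) (\<lambda>(i, b::bool). P i)"
  interpret O: prob_space \<Omega> unfolding \<Omega>_def using P by (intro prob_space_PiM) auto
  have sets: "?Box \<in> sets ?M" "?A \<in> sets ?M" "?B \<in> sets ?M"
    using fin C D by (auto intro!: sets.finite_UN sets.Int finite_subset[of _ I] simp del: Int_UN_distrib UN_simps)
  have m[measurable]: "coord_select I s \<in> \<Omega> \<rightarrow>\<^sub>M ?M" for s
    unfolding \<Omega>_def by (rule measurable_coord_select) auto
  define X where "X s = {\<omega> \<in> space \<Omega>. coord_select I s \<omega> \<in> ?Box}" for s
  define Y where "Y s = {\<omega> \<in> space \<Omega>. coord_select I s \<omega> \<in> ?A \<and> coord_select I (I - s) \<omega> \<in> ?B}" for s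
  have XY: "X s \<in> sets \<Omega>" "Y s \<in> sets \<Omega>" for s
    unfolding X_def Y_def using sets by measurable
  have X: "measure \<Omega> (X s) = measure ?M ?Box" for s
  proof -
    have "measure ?M ?Box = measure (distr \<Omega> ?M (coord_select I s)) ?Box"
      unfolding \<Omega>_def using P by (subst distr_coord_select) auto
    also have "\<dots> = measure \<Omega> (X s)"
      using sets by (subst measure_distr) (auto simp: X_def intro!: arg_cong[where f="measure \<Omega>"])
    finally show ?thesis ..
  qed
  have Y: "measure \<Omega> (Y s) = measure ?M ?A * measure ?M ?B" if "s \<subseteq> I" for s
    unfolding Y_def \<Omega>_def by (rule measure_coord_select_complement[OF fin P that sets(2,3)])
  have count: "card {s \<in> Pow I. \<omega> \<in> X s} \<le> card {s \<in> Pow I. \<omega> \<in> Y s}" if \<omega>: "\<omega> \<in> space \<Omega>" for \<omega>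
  proof -
    let ?x = "\<lambda>s. coord_select I s \<omega>" and ?S = "{s \<in> Pow I. \<omega> \<in> X s}"
    have sp: "?x s \<in> space ?M" for s using measurable_space[OF m \<omega>] .
    have "\<forall>s\<in>?S. \<exists>K L. K \<subseteq> I \<and> L \<subseteq> I - K \<and> ?x s \<in> C K \<and> ?x s \<in> D L"
      by (auto simp: X_def)
    then obtain K L where KL: "\<And>s. s \<in> ?S \<Longrightarrow> K s \<subseteq> I \<and> L s \<subseteq> I - K s \<and> ?x s \<in> C (K s) \<and> ?x s \<in> D (L s)"
      by metis
    \<comment> \<open>The colouring of \<open>s\<close> is its witness \<open>K s\<close>.
      Membership in \<open>C (K s)\<close> survives agreement with \<open>s\<close> on
      \<open>K s\<close>; membership in \<open>D (L s')\<close> survives agreement with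
      \<open>s'\<close> off \<open>K s'\<close>, because \<open>L s'\<close> avoids
      \<open>K s'\<close>.\<close>
    have "card ?S \<le> card {z \<in> Pow I. (\<exists>s\<in>?S. z \<inter> K s = s \<inter> K s) \<and> (\<exists>s\<in>?S. (I - z) - K s = s - K s)}"
      using fin by (intro reimer_butterfly) auto
    also have "\<dots> \<le> card {s \<in> Pow I. \<omega> \<in> Y s}"
    proof (intro card_mono subsetI)
      show "finite {s \<in> Pow I. \<omega> \<in> Y s}" using fin by simp
      fix z assume "z \<in> {z \<in> Pow I. (\<exists>s\<in>?S. z \<inter> K s = s \<inter> K s) \<and> (\<exists>s\<in>?S. (I - z) - K s = s - K s)}"
      then obtain s s' where z: "z \<subseteq> I" and s: "s \<in> ?S" "z \<inter> K s = s \<inter> K s"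
        and s': "s' \<in> ?S" "(I - z) - K s' = s' - K s'" by blast
      have "?x z \<in> C (K s)"
      proof (rule Cd[of _ "?x s"])
        fix i assume "i \<in> K s"
        then have "i \<in> z \<longleftrightarrow> i \<in> s" using s(2) by blast
        then show "?x z i = ?x s i" by (simp add: coord_select_def)
      qed (use KL[OF s(1)] sp in auto)
      moreover have "?x (I - z) \<in> D (L s')"
      proof (rule Dd[of _ "?x s'"])
        fix i assume "i \<in> L s'"
        then have "i \<in> I" "i \<notin> K s'" using KL[OF s'(1)] by auto
        then have "i \<in> I - z \<longleftrightarrow> i \<in> s'" using s'(2) by blast
        then show "?x (I - z) i = ?x s' i" using \<open>i \<in> I\<close> by (simp add: coord_select_def)
      qed (use KL[OF s'(1)] sp in auto)
      ultimately show "z \<in> {s \<in> Pow I. \<omega> \<in> Y s}"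
        using KL[OF s(1)] KL[OF s'(1)] z \<omega> by (auto simp: Y_def)
    qed
    finally show ?thesis .
  qed
  have card: "(\<Sum>s\<in>Pow I. indicator (Z s) \<omega>) = real (card {s \<in> Pow I. \<omega> \<in> Z s})" for Z :: "'i set \<Rightarrow> ('i \<times> bool \<Rightarrow> 'a) set" and \<omega>
    using fin by (simp add: indicator_def sum.If_cases Int_def)
  have "2 ^ card I * measure ?M ?Box = (\<Sum>s\<in>Pow I. measure \<Omega> (X s))"
    using fin by (simp add: X card_Pow)
  also have "\<dots> = (\<Sum>s\<in>Pow I. \<integral>\<omega>. indicator (X s) \<omega> \<partial>\<Omega>)"
    using XY by simp
  also have "\<dots> = (\<integral>\<omega>. (\<Sum>s\<in>Pow I. indicator (X s) \<omega>) \<partial>\<Omega>)"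
    using XY by (subst Bochner_Integration.integral_sum) (auto simp: O.emeasure_eq_measure)
  also have "\<dots> \<le> (\<integral>\<omega>. (\<Sum>s\<in>Pow I. indicator (Y s) \<omega>) \<partial>\<Omega>)"
  proof (rule integral_mono)
    show "integrable \<Omega> (\<lambda>\<omega>. \<Sum>s\<in>Pow I. indicat_real (X s) \<omega>)"
      using XY by (intro Bochner_Integration.integrable_sum) (auto simp: O.emeasure_eq_measure)
    show "integrable \<Omega> (\<lambda>\<omega>. \<Sum>s\<in>Pow I. indicat_real (Y s) \<omega>)"
      using XY by (intro Bochner_Integration.integrable_sum) (auto simp: O.emeasure_eq_measure)
  qed (simp only: card of_nat_le_iff count)
  also have "\<dots> = (\<Sum>s\<in>Pow I. \<integral>\<omega>. indicator (Y s) \<omega> \<partial>\<Omega>)"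
    using XY by (subst Bochner_Integration.integral_sum) (auto simp: O.emeasure_eq_measure)
  also have "\<dots> = (\<Sum>s\<in>Pow I. measure \<Omega> (Y s))"
    using XY by simp
  also have "\<dots> = 2 ^ card I * (measure ?M ?A * measure ?M ?B)"
    using fin by (simp add: Y card_Pow)
  finally show ?thesis by simp
qed

section \<open>The Souslin operation\<close>

text \<open>Stage \<open>k\<close> fixes entry \<open>k\<close> and never touches it again, so the
  diagonal of the stages agrees with stage \<open>k\<close> below \<open>k\<close>; the predicate at
  \<open>k\<close> sees only that prefix.\<close>

lemma dependent_prefix_choice:
  fixes P :: "nat \<Rightarrow> (nat \<Rightarrow> 'b) \<Rightarrow> bool"
  assumes "P 0 m0"
    and det: "\<And>k m m'. P k m \<Longrightarrow> (\<And>i. i < k \<Longrightarrow> m' i = m i) \<Longrightarrow> P k m'"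
    and step: "\<And>k m. P k m \<Longrightarrow> \<exists>j. P (Suc k) (m(k := j))"
  shows "\<exists>m. \<forall>k. P k m"
proof -
  have "\<exists>f. \<forall>k. P k (f k) \<and> (\<exists>j. f (Suc k) = (f k)(k := j))"
  proof (rule dependent_nat_choice[of P "\<lambda>k g h. \<exists>j. h = g(k := j)"])
    show "\<exists>m. P 0 m" by (rule exI[of _ m0]) (rule assms(1))
    show "\<exists>m'. P (Suc k) m' \<and> (\<exists>j. m' = m(k := j))" if P: "P k m" for m k
    proof -
      from step[OF P] obtain j where "P (Suc k) (m(k := j))" by (rule exE)
      then show ?thesis by (intro exI[of _ "m(k := j)"] conjI exI[of _ j] refl)
    qed
  qed
  then obtain f where "\<forall>k. P k (f k) \<and> (\<exists>j. f (Suc k) = (f k)(k := j))"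
    by (rule exE)
  then have f: "P k (f k)" "\<exists>j. f (Suc k) = (f k)(k := j)" for k
    by simp_all
  have "f (i + Suc d) i = f (Suc i) i" for i d
  proof (induction d)
    case (Suc d)
    from f(2)[of "i + Suc d"] obtain j where "f (Suc (i + Suc d)) = (f (i + Suc d))(i + Suc d := j)" ..
    then show ?case using Suc by simp
  qed simp
  then have agree: "f (Suc i) i = f k i" if "i < k" for i k
    using less_imp_Suc_add[OF that] by (metis add_Suc_right)
  have "P k (\<lambda>i. f (Suc i) i)" for k
    using f(1) agree by (rule det)
  then show ?thesis by (intro exI[of _ "\<lambda>i. f (Suc i) i"] allI)
qed

text \<open>Koenig's lemma: the prefix is extended so that infinitely many rows keep sharing it,
  which the pigeonhole principle allows because entry \<open>l\<close> takes at most
  \<open>m l + 1\<close> values. Infinitude also yields rows with arbitrarily large index.\<close>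

lemma konig_bounded:
  fixes s :: "nat \<Rightarrow> nat \<Rightarrow> nat"
  assumes "\<And>k i. s k i \<le> m i"
  shows "\<exists>\<sigma>. \<forall>l. \<exists>k\<ge>l. \<forall>i<l. s k i = \<sigma> i"
proof -
  have "\<exists>\<sigma>. \<forall>l. infinite {k. \<forall>i<l. s k i = \<sigma> i}"
  proof (rule dependent_prefix_choice[of "\<lambda>l \<sigma>. infinite {k. \<forall>i<l. s k i = \<sigma> i}" "\<lambda>_. 0"])
    show "infinite {k. \<forall>i<(0::nat). s k i = (0::nat)}" by simp
    show "infinite {k. \<forall>i<l. s k i = \<tau>' i}" if "infinite {k. \<forall>i<l. s k i = \<tau> i}" "\<And>i. i < l \<Longrightarrow> \<tau>' i = \<tau> i"
      for l \<tau> \<tau>'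
      using that by (simp cong: conj_cong imp_cong)
    show "\<exists>j. infinite {k. \<forall>i<Suc l. s k i = (\<tau>(l := j)) i}" if inf: "infinite {k. \<forall>i<l. s k i = \<tau> i}"
      for l \<tau>
    proof -
      let ?A = "{k. \<forall>i<l. s k i = \<tau> i}"
      have "finite ((\<lambda>k. s k l) ` ?A)"
        using assms by (auto intro: finite_subset[OF _ finite_atMost[of "m l"]])
      from pigeonhole_infinite[OF inf this]
      obtain k0 where k0: "infinite {k \<in> ?A. s k l = s k0 l}" by blast
      have eq: "{k \<in> ?A. s k l = s k0 l} = {k. \<forall>i<Suc l. s k i = (\<tau>(l := s k0 l)) i}"
        by (auto simp: less_Suc_eq)
      show ?thesis using k0 unfolding eq by (rule exI)
    qed
  qed
  then obtain \<sigma> where \<sigma>: "\<forall>l. infinite {k. \<forall>i<l. s k i = \<sigma> i}" by (rule exE)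
  have "\<exists>k\<ge>l. \<forall>i<l. s k i = \<sigma> i" for l
    using spec[OF \<sigma>, of l] unfolding infinite_nat_iff_unbounded_le by blast
  then show ?thesis by (intro exI[of _ \<sigma>] allI)
qed

text \<open>The set lies between a countable union of inner approximations and a measurable hull
  attaining its outer measure; finiteness makes the difference of the two a null set.\<close>

lemma (in finite_measure) completion_if_inner_regular:
  assumes C: "C \<subseteq> space M"
    and inner: "\<And>a. a < outer_measure_of M C \<Longrightarrow> \<exists>D\<in>sets M. D \<subseteq> C \<and> a \<le> emeasure M D"
  shows "C \<in> sets (completion M)"
proof -
  obtain E where E: "E \<in> sets M" "C \<subseteq> E" "outer_measure_of M C = emeasure M E"
    using outer_measure_of_attain[OF C] by blast
  have "\<exists>D\<in>sets M. D \<subseteq> C \<and> measure M E - 1 / Suc j \<le> measure M D" for j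
  proof (cases "measure M E - 1 / Suc j < 0")
    \<comment> \<open>A negative bound would become 0 in the extended nonnegative reals, and 0 need
      not be strictly below the outer measure.\<close>
    case True
    then show ?thesis by (intro bexI[of _ "{}"]) auto
  next
    case False
    then have "ennreal (measure M E - 1 / Suc j) < outer_measure_of M C"
      unfolding E(3) emeasure_eq_measure by (simp add: ennreal_less_iff)
    from inner[OF this] show ?thesis
      by (auto simp: emeasure_eq_measure)
  qed
  then obtain D where D: "\<And>j. D j \<in> sets M" "\<And>j. D j \<subseteq> C" "\<And>j. measure M E - 1 / Suc j \<le> measure M (D j)"
    by metis
  let ?D = "\<Union>j. D j"
  have D': "?D \<in> sets M" "?D \<subseteq> C" using D by auto
  have "measure M E - 1 / Suc j \<le> measure M ?D" for j
    using D(3)[of j] D(1) D'(1) by (meson UN_upper UNIV_I finite_measure_mono order_trans)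
  moreover have "(\<lambda>j. measure M E - 1 / Suc j) \<longlonglongrightarrow> measure M E - 0"
    by (intro tendsto_intros LIMSEQ_Suc lim_1_over_n)
  ultimately have "measure M E \<le> measure M ?D"
    using LIMSEQ_le_const2[of "\<lambda>j. measure M E - 1 / Suc j" "measure M E" "measure M ?D"] by auto
  moreover have "measure M (E - ?D) = measure M E - measure M ?D"
    using D' E by (intro finite_measure_Diff) auto
  ultimately have "measure M (E - ?D) = 0"
    using measure_nonneg[of M "E - ?D"] by linarith
  then have "E - ?D \<in> null_sets M"
    using D' E by (auto simp: null_sets_def emeasure_eq_measure)
  moreover have "C = ?D \<union> (C - ?D)" "C - ?D \<subseteq> E - ?D" using D' E by auto
  ultimately show ?thesis
    using D'(1) by (intro sets_completionI[of _ ?D "C - ?D"])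
qed

text \<open>
  By continuity from below of the outer measure one may bound the branches by a fixed sequence \<open>m\<close> at
  small cost; the bounded branches form a finitely branching tree, so that the bounded part contains a
  countable intersection of measurable sets.
\<close>

theorem (in finite_measure) sets_completion_Souslin:
  fixes Q :: "nat \<Rightarrow> 'a \<Rightarrow> (nat \<Rightarrow> nat) \<Rightarrow> bool" and N :: "nat \<Rightarrow> nat"
  assumes meas: "\<And>n \<sigma>. {t \<in> space M. Q n t \<sigma>} \<in> sets M"
    and det: "\<And>n t \<sigma> \<sigma>'. (\<And>i. i < N n \<Longrightarrow> \<sigma>' i = \<sigma> i) \<Longrightarrow> Q n t \<sigma> \<Longrightarrow> Q n t \<sigma>'"
  shows "{t \<in> space M. \<exists>\<sigma>. \<forall>n. Q n t \<sigma>} \<in> sets (completion M)"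
proof (rule completion_if_inner_regular)
  let ?C = "{t \<in> space M. \<exists>\<sigma>. \<forall>n. Q n t \<sigma>}"
  show "?C \<subseteq> space M" by auto
  fix a assume a: "a < outer_measure_of M ?C"
  define C where "C k m = {t \<in> space M. \<exists>\<sigma>. (\<forall>i<k. \<sigma> i \<le> m i) \<and> (\<forall>n. Q n t \<sigma>)}" for k and m :: "nat \<Rightarrow> nat"
  have "\<exists>m. \<forall>k. a < outer_measure_of M (C k m)"
  proof (rule dependent_prefix_choice[of "\<lambda>k m. a < outer_measure_of M (C k m)" "\<lambda>_. 0"])
    show "a < outer_measure_of M (C 0 (\<lambda>_. 0))" using a by (simp add: C_def)
    fix k m
    {
      fix m' assume "a < outer_measure_of M (C k m)" "\<And>i. i < k \<Longrightarrow> m' i = m i"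
      then show "a < outer_measure_of M (C k m')" by (simp add: C_def cong: conj_cong imp_cong)
    next
      assume less: "a < outer_measure_of M (C k m)"
      have "incseq (\<lambda>j. C (Suc k) (m(k := j)))"
      proof (intro incseq_SucI subsetI)
        fix j t assume "t \<in> C (Suc k) (m(k := j))"
        then obtain \<sigma> where \<sigma>: "t \<in> space M" "\<And>i. i < Suc k \<Longrightarrow> \<sigma> i \<le> (m(k := j)) i" "\<forall>n. Q n t \<sigma>"
          unfolding C_def by blast
        have "\<sigma> i \<le> (m(k := Suc j)) i" if "i < Suc k" for i
          using \<sigma>(2)[OF that] by (auto split: if_splits)
        with \<sigma> show "t \<in> C (Suc k) (m(k := Suc j))" unfolding C_def by blast
      qed
      \<comment> \<open>Continuity from below holds for outer measure on arbitrary increasing sets,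
        so no measurability of the sets \<open>C k m\<close> is presupposed.\<close>
      then have "(SUP j. outer_measure_of M (C (Suc k) (m(k := j)))) = outer_measure_of M (\<Union>j. C (Suc k) (m(k := j)))"
        by (intro SUP_outer_measure_of_incseq) (auto simp: C_def)
      also have "C k m \<subseteq> (\<Union>j. C (Suc k) (m(k := j)))"
      proof
        fix t assume "t \<in> C k m"
        then obtain \<sigma> where \<sigma>: "t \<in> space M" "\<And>i. i < k \<Longrightarrow> \<sigma> i \<le> m i" "\<forall>n. Q n t \<sigma>"
          unfolding C_def by blast
        have "\<sigma> i \<le> (m(k := \<sigma> k)) i" if "i < Suc k" for i
          using \<sigma>(2)[of i] that by (auto simp: less_Suc_eq)
        with \<sigma> have "t \<in> C (Suc k) (m(k := \<sigma> k))" unfolding C_def by blast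
        then show "t \<in> (\<Union>j. C (Suc k) (m(k := j)))" by blast
      qed
      then have "outer_measure_of M (C k m) \<le> outer_measure_of M (\<Union>j. C (Suc k) (m(k := j)))"
        by (rule outer_measure_of_mono)
      finally have "a < (SUP j. outer_measure_of M (C (Suc k) (m(k := j))))"
        using less by simp
      then show "\<exists>j. a < outer_measure_of M (C (Suc k) (m(k := j)))"
        by (simp add: less_SUP_iff)
    }
  qed
  then obtain m where m: "\<And>k. a < outer_measure_of M (C k m)" by blast
  define trunc where "trunc l \<sigma> i = (if i < l then \<sigma> i else 0)" for l i and \<sigma> :: "nat \<Rightarrow> nat"
  \<comment> \<open>Finite lists are countable: quantifying over padded lists instead of all
    branches makes \<open>D k\<close> below a countable union of measurable sets.\<close>
  define pad where "pad xs i = (if i < length xs then xs ! i else 0)" for xs :: "nat list" and i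
  have trunc_pad: "trunc l \<sigma> = pad (map \<sigma> [0..<l])" for l \<sigma>
    by (auto simp: trunc_def pad_def fun_eq_iff)
  \<comment> \<open>The first \<open>b k\<close> entries decide all conditions below
    \<open>k\<close>. Later entries may be replaced by 0, which respects every bound
    \<open>m i\<close>. The added \<open>0\<close> keeps \<open>Max\<close> meaningful for
    \<open>k = 0\<close>.\<close>
  define b where "b k = Max (N ` {..<k} \<union> {0})" for k
  have b: "N n \<le> b k" if "n < k" for n k
    using that by (auto simp: b_def)
  define D where "D k = {t \<in> space M. \<exists>xs. (\<forall>i. pad xs i \<le> m i) \<and> (\<forall>n<k. Q n t (pad xs))}" for k
  have D: "D k \<in> sets M" for k
    unfolding D_def using meas by measurable
  have CD: "C (b k) m \<subseteq> D k" for k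
  proof
    fix t assume "t \<in> C (b k) m"
    then obtain \<sigma> where \<sigma>: "t \<in> space M" "\<And>i. i < b k \<Longrightarrow> \<sigma> i \<le> m i" "\<And>n. Q n t \<sigma>"
      unfolding C_def by blast
    have "Q n t (trunc (b k) \<sigma>)" if "n < k" for n
      using b[OF that] by (intro det[OF _ \<sigma>(3)]) (auto simp: trunc_def)
    moreover have "trunc (b k) \<sigma> i \<le> m i" for i
      using \<sigma>(2) by (auto simp: trunc_def)
    ultimately show "t \<in> D k"
      unfolding D_def using \<sigma>(1) by (auto simp: trunc_pad)
  qed
  have "a \<le> emeasure M (D k)" for k
    using m[of "b k"] outer_measure_of_mono[OF CD[of k], of M] D[of k] by simp
  then have "a \<le> (INF k. emeasure M (D k))" by (intro INF_greatest)
  also have "decseq D"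
    unfolding D_def by (intro decseq_SucI) (use less_SucI in blast)
  then have "(INF k. emeasure M (D k)) = emeasure M (\<Inter>k. D k)"
    using D by (intro INF_emeasure_decseq) auto
  finally have "a \<le> emeasure M (\<Inter>k. D k)" .
  moreover have "(\<Inter>k. D k) \<subseteq> ?C"
  proof
    fix t assume t: "t \<in> (\<Inter>k. D k)"
    then have "\<forall>k. \<exists>\<sigma>. (\<forall>i. \<sigma> i \<le> m i) \<and> (\<forall>n<k. Q n t \<sigma>)"
      unfolding D_def by blast
    then obtain s where s: "\<And>k i. s k i \<le> m i" "\<And>k n. n < k \<Longrightarrow> Q n t (s k)" by metis
    from konig_bounded[OF s(1)]
    obtain \<sigma> where \<sigma>: "\<forall>l. \<exists>k\<ge>l. \<forall>i<l. s k i = \<sigma> i" by (rule exE)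
    have "Q n t \<sigma>" for n
    proof -
      \<comment> \<open>The row must lie beyond \<open>n\<close> to satisfy condition
        \<open>n\<close>, and must agree with the limit branch on the \<open>N n\<close> entries
        that this condition reads.\<close>
      obtain k where k: "k \<ge> max (N n) (Suc n)" "\<And>i. i < max (N n) (Suc n) \<Longrightarrow> s k i = \<sigma> i"
        using \<sigma> by blast
      have "Q n t (s k)" using k by (intro s) auto
      then show ?thesis using k(2) by (intro det[of n \<sigma> "s k"]) auto
    qed
    moreover have "t \<in> space M" using t by (auto simp: D_def)
    ultimately show "t \<in> ?C" by blast
  qed
  moreover have "(\<Inter>k. D k) \<in> sets M" using D by auto
  ultimately show "\<exists>D\<in>sets M. D \<subseteq> ?C \<and> a \<le> emeasure M D" by blast
qed

text \<open>
  The auxiliary branch \<open>\<tau>\<close> absorbs countable unions, which would otherwise destroy the finite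
  determination of the conditions \<open>Q n\<close>.
\<close>

definition souslin_witness ::
  "'a measure \<Rightarrow> ('a \<Rightarrow> (nat \<Rightarrow> nat) \<Rightarrow> bool) \<Rightarrow>
    (nat \<Rightarrow> 'a \<Rightarrow> (nat \<Rightarrow> nat) \<Rightarrow> (nat \<Rightarrow> nat) \<Rightarrow> bool) \<Rightarrow> (nat \<Rightarrow> nat) \<Rightarrow> bool" where
  "souslin_witness M E Q N \<longleftrightarrow>
     (\<forall>n \<sigma> \<tau>. {t \<in> space M. Q n t \<sigma> \<tau>} \<in> sets M) \<and>
     (\<forall>n t \<sigma> \<sigma>' \<tau> \<tau>'. Q n t \<sigma> \<tau> \<longrightarrow> (\<forall>i<N n. \<sigma>' i = \<sigma> i \<and> \<tau>' i = \<tau> i) \<longrightarrow> Q n t \<sigma>' \<tau>') \<and>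
     (\<forall>t\<in>space M. \<forall>\<sigma>. E t \<sigma> \<longleftrightarrow> (\<exists>\<tau>. \<forall>n. Q n t \<sigma> \<tau>))"

definition souslin_rel :: "'a measure \<Rightarrow> ('a \<Rightarrow> (nat \<Rightarrow> nat) \<Rightarrow> bool) \<Rightarrow> bool" where
  "souslin_rel M E \<longleftrightarrow> (\<exists>Q N. souslin_witness M E Q N)"

section \<open>Closure properties of Souslin relations\<close>

lemma souslin_witnessD:
  assumes "souslin_witness M E Q N"
  shows "{t \<in> space M. Q n t \<sigma> \<tau>} \<in> sets M"
    and "Q n t \<sigma> \<tau> \<Longrightarrow> (\<And>i. i < N n \<Longrightarrow> \<sigma>' i = \<sigma> i) \<Longrightarrow> (\<And>i. i < N n \<Longrightarrow> \<tau>' i = \<tau> i) \<Longrightarrow> Q n t \<sigma>' \<tau>'"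
    and "t \<in> space M \<Longrightarrow> E t \<sigma> \<longleftrightarrow> (\<exists>\<tau>. \<forall>n. Q n t \<sigma> \<tau>)"
proof -
  note w = assms[unfolded souslin_witness_def]
  show "{t \<in> space M. Q n t \<sigma> \<tau>} \<in> sets M" using w by simp
  show "t \<in> space M \<Longrightarrow> E t \<sigma> \<longleftrightarrow> (\<exists>\<tau>. \<forall>n. Q n t \<sigma> \<tau>)" using w by simp
  assume Q: "Q n t \<sigma> \<tau>" and "\<And>i. i < N n \<Longrightarrow> \<sigma>' i = \<sigma> i" "\<And>i. i < N n \<Longrightarrow> \<tau>' i = \<tau> i"
  then show "Q n t \<sigma>' \<tau>'"
    by (intro w[THEN conjunct2, THEN conjunct1, rule_format, OF Q] conjI)
qed

lemma souslin_relI: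
  fixes Q :: "nat \<Rightarrow> 'a \<Rightarrow> (nat \<Rightarrow> nat) \<Rightarrow> (nat \<Rightarrow> nat) \<Rightarrow> bool" and N :: "nat \<Rightarrow> nat"
  assumes Q: "\<And>n \<sigma> \<tau>. {t \<in> space M. Q n t \<sigma> \<tau>} \<in> sets M"
    and N: "\<And>n t \<sigma> \<sigma>' \<tau> \<tau>'. Q n t \<sigma> \<tau> \<Longrightarrow> (\<And>i. i < N n \<Longrightarrow> \<sigma>' i = \<sigma> i) \<Longrightarrow> (\<And>i. i < N n \<Longrightarrow> \<tau>' i = \<tau> i)
      \<Longrightarrow> Q n t \<sigma>' \<tau>'"
    and E: "\<And>t \<sigma>. t \<in> space M \<Longrightarrow> E t \<sigma> \<longleftrightarrow> (\<exists>\<tau>. \<forall>n. Q n t \<sigma> \<tau>)"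
  shows "souslin_rel M E"
proof -
  have "souslin_witness M E Q N"
    unfolding souslin_witness_def
  proof (intro conjI allI impI ballI)
    show "Q n t \<sigma>' \<tau>'" if "Q n t \<sigma> \<tau>" "\<forall>i<N n. \<sigma>' i = \<sigma> i \<and> \<tau>' i = \<tau> i" for n t \<sigma> \<sigma>' \<tau> \<tau>'
      using that(1) by (rule N) (use that(2) in auto)
  qed (rule Q E, assumption?)+
  then show ?thesis unfolding souslin_rel_def by blast
qed

lemma souslin_rel_determined:
  assumes "\<And>\<sigma>. {t \<in> space M. E t \<sigma>} \<in> sets M"
    and "\<And>t \<sigma> \<sigma>'. E t \<sigma> \<Longrightarrow> (\<And>i. i < N \<Longrightarrow> \<sigma>' i = \<sigma> i) \<Longrightarrow> E t \<sigma>'"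
  shows "souslin_rel M E"
  by (rule souslin_relI[of M "\<lambda>n t \<sigma> \<tau>. E t \<sigma>" "\<lambda>_. N"]) (use assms in auto)

text \<open>One auxiliary branch codes countably many: its \<open>j\<close>-th row serves as the
  auxiliary branch of \<open>E j\<close>, and the conditions of all \<open>j\<close> are enumerated
  by pairs.\<close>

lemma souslin_rel_all:
  fixes E :: "nat \<Rightarrow> 'a \<Rightarrow> (nat \<Rightarrow> nat) \<Rightarrow> bool"
  assumes "\<And>j. souslin_rel M (E j)"
  shows "souslin_rel M (\<lambda>t \<sigma>. \<forall>j. E j t \<sigma>)"
proof -
  have "\<forall>j. \<exists>Q N. souslin_witness M (E j) Q N"
    using assms by (simp add: souslin_rel_def)
  then obtain Q N where w: "\<And>j. souslin_witness M (E j) (Q j) (N j)" by metis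
  note Q = souslin_witnessD(1)[OF w] and N = souslin_witnessD(2)[OF w] and E = souslin_witnessD(3)[OF w]
  let ?Q = "\<lambda>n t \<sigma> \<tau>. case prod_decode n of (j, n) \<Rightarrow> Q j n t \<sigma> (\<lambda>i. \<tau> (prod_encode (j, i)))"
  \<comment> \<open>The sum dominates the code of every entry that is read in row \<open>j\<close>;
    the summand \<open>N j n\<close> takes care of \<open>\<sigma>\<close>.\<close>
  let ?N = "\<lambda>n. case prod_decode n of (j, n) \<Rightarrow> N j n + Suc (\<Sum>i<N j n. prod_encode (j, i))"
  show ?thesis
  proof (rule souslin_relI[of M ?Q ?N])
    show "{t \<in> space M. ?Q n t \<sigma> \<tau>} \<in> sets M" for n \<sigma> \<tau>
      using Q by (simp split: prod.split)
    show "?Q n t \<sigma>' \<tau>'" if *: "?Q n t \<sigma> \<tau>" "\<And>i. i < ?N n \<Longrightarrow> \<sigma>' i = \<sigma> i" "\<And>i. i < ?N n \<Longrightarrow> \<tau>' i = \<tau> i"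
      for n t \<sigma> \<sigma>' \<tau> \<tau>'
    proof (cases "prod_decode n")
      case (Pair j k)
      have "prod_encode (j, i) < ?N n" if "i < N j k" for i
      proof -
        have "prod_encode (j, i) \<le> (\<Sum>i<N j k. prod_encode (j, i))"
          using that by (intro member_le_sum) auto
        then show ?thesis by (simp add: Pair)
      qed
      then show ?thesis
        using * N[of j k t \<sigma> "\<lambda>i. \<tau> (prod_encode (j, i))" \<sigma>' "\<lambda>i. \<tau>' (prod_encode (j, i))"]
        by (simp add: Pair)
    qed
    fix t \<sigma> assume t: "t \<in> space M"
    show "(\<forall>j. E j t \<sigma>) \<longleftrightarrow> (\<exists>\<tau>. \<forall>n. ?Q n t \<sigma> \<tau>)"
    proof
      assume "\<forall>j. E j t \<sigma>"
      then have "\<forall>j. \<exists>\<tau>. \<forall>n. Q j n t \<sigma> \<tau>" using E[OF t] by simp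
      then obtain \<tau> where \<tau>: "\<forall>j n. Q j n t \<sigma> (\<tau> j)" by metis
      then show "\<exists>\<tau>. \<forall>n. ?Q n t \<sigma> \<tau>"
        by (intro exI[of _ "\<lambda>k. case prod_decode k of (j, i) \<Rightarrow> \<tau> j i"]) (simp split: prod.split)
    next
      assume "\<exists>\<tau>. \<forall>n. ?Q n t \<sigma> \<tau>"
      then obtain \<tau> where \<tau>: "\<forall>n. ?Q n t \<sigma> \<tau>" ..
      have "Q j n t \<sigma> (\<lambda>i. \<tau> (prod_encode (j, i)))" for j n
        using spec[OF \<tau>, of "prod_encode (j, n)"] by simp
      then show "\<forall>j. E j t \<sigma>" using E[OF t] by blast
    qed
  qed
qed

text \<open>The auxiliary branch stores the chosen \<open>j\<close> in its entry 0 and a branch for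
  \<open>E j\<close> after it. Conditions belonging to other indices hold vacuously, so each one
  still reads finitely many entries.\<close>

lemma souslin_rel_ex:
  fixes E :: "nat \<Rightarrow> 'a \<Rightarrow> (nat \<Rightarrow> nat) \<Rightarrow> bool"
  assumes "\<And>j. souslin_rel M (E j)"
  shows "souslin_rel M (\<lambda>t \<sigma>. \<exists>j. E j t \<sigma>)"
proof -
  have "\<forall>j. \<exists>Q N. souslin_witness M (E j) Q N"
    using assms by (simp add: souslin_rel_def)
  then obtain Q N where w: "\<And>j. souslin_witness M (E j) (Q j) (N j)" by metis
  note Q = souslin_witnessD(1)[OF w] and N = souslin_witnessD(2)[OF w] and E = souslin_witnessD(3)[OF w]
  let ?Q = "\<lambda>n t \<sigma> \<tau>. case prod_decode n of (j, n) \<Rightarrow> \<tau> 0 = j \<longrightarrow> Q j n t \<sigma> (\<lambda>i. \<tau> (Suc i))"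
  let ?N = "\<lambda>n. case prod_decode n of (j, n) \<Rightarrow> Suc (N j n)"
  show ?thesis
  proof (rule souslin_relI[of M ?Q ?N])
    show "{t \<in> space M. ?Q n t \<sigma> \<tau>} \<in> sets M" for n \<sigma> \<tau>
      using Q by (auto split: prod.split)
    show "?Q n t \<sigma>' \<tau>'" if *: "?Q n t \<sigma> \<tau>" "\<And>i. i < ?N n \<Longrightarrow> \<sigma>' i = \<sigma> i" "\<And>i. i < ?N n \<Longrightarrow> \<tau>' i = \<tau> i"
      for n t \<sigma> \<sigma>' \<tau> \<tau>'
    proof (cases "prod_decode n")
      case (Pair j k)
      show ?thesis
        using * N[of j k t \<sigma> "\<lambda>i. \<tau> (Suc i)" \<sigma>' "\<lambda>i. \<tau>' (Suc i)"]
        by (simp add: Pair)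
    qed
    fix t \<sigma> assume t: "t \<in> space M"
    show "(\<exists>j. E j t \<sigma>) \<longleftrightarrow> (\<exists>\<tau>. \<forall>n. ?Q n t \<sigma> \<tau>)"
    proof
      assume "\<exists>j. E j t \<sigma>"
      then obtain j \<tau> where "\<forall>n. Q j n t \<sigma> \<tau>" using E[OF t] by blast
      then show "\<exists>\<tau>. \<forall>n. ?Q n t \<sigma> \<tau>"
        by (intro exI[of _ "case_nat j \<tau>"]) (simp split: prod.split)
    next
      assume "\<exists>\<tau>. \<forall>n. ?Q n t \<sigma> \<tau>"
      then obtain \<tau> where \<tau>: "\<forall>n. ?Q n t \<sigma> \<tau>" ..
      have "Q (\<tau> 0) n t \<sigma> (\<lambda>i. \<tau> (Suc i))" for n
        using spec[OF \<tau>, of "prod_encode (\<tau> 0, n)"] by simp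
      then show "\<exists>j. E j t \<sigma>" using E[OF t] by blast
    qed
  qed
qed

text \<open>Interleaving \<open>\<sigma>\<close> and \<open>\<tau>\<close> as the even and odd
  entries of one branch merges both existential quantifiers into a single Souslin operation.\<close>

lemma (in finite_measure) souslin_rel_projection:
  assumes "souslin_rel M E"
  shows "{t \<in> space M. \<exists>\<sigma>. E t \<sigma>} \<in> sets (completion M)"
proof -
  obtain Q N where w: "souslin_witness M E Q N"
    using assms unfolding souslin_rel_def by blast
  note Q = souslin_witnessD(1)[OF w] and N = souslin_witnessD(2)[OF w] and E = souslin_witnessD(3)[OF w]
  let ?Q = "\<lambda>n t \<rho>. Q n t (\<lambda>i. \<rho> (2 * i)) (\<lambda>i. \<rho> (Suc (2 * i)))"
  have "{t \<in> space M. \<exists>\<rho>. \<forall>n. ?Q n t \<rho>} \<in> sets (completion M)"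
  proof (rule sets_completion_Souslin[of ?Q "\<lambda>n. 2 * N n"])
    show "?Q n t \<rho>'" if "\<And>i. i < 2 * N n \<Longrightarrow> \<rho>' i = \<rho> i" "?Q n t \<rho>" for n t \<rho> \<rho>'
      using that(2) by (rule N) (simp_all add: that(1))
  qed (rule Q)
  also have "{t \<in> space M. \<exists>\<rho>. \<forall>n. ?Q n t \<rho>} = {t \<in> space M. \<exists>\<sigma>. E t \<sigma>}"
  proof -
    have "(\<exists>\<rho>. \<forall>n. ?Q n t \<rho>) \<longleftrightarrow> (\<exists>\<sigma> \<tau>. \<forall>n. Q n t \<sigma> \<tau>)" for t
    proof safe
      fix \<sigma> \<tau> assume "\<forall>n. Q n t \<sigma> \<tau>"
      then show "\<exists>\<rho>. \<forall>n. ?Q n t \<rho>"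
        by (intro exI[of _ "\<lambda>i. if even i then \<sigma> (i div 2) else \<tau> (i div 2)"]) simp
    qed blast
    then show ?thesis by (simp add: E cong: conj_cong)
  qed
  finally show ?thesis .
qed

text \<open>Requiring the negation as well makes the class closed under complements and countable
  unions, so that induction over \<open>sigma_sets\<close> applies.\<close>

definition bisouslin_rel :: "'a measure \<Rightarrow> ('a \<Rightarrow> (nat \<Rightarrow> nat) \<Rightarrow> bool) \<Rightarrow> bool" where
  "bisouslin_rel M E \<longleftrightarrow> souslin_rel M E \<and> souslin_rel M (\<lambda>t \<sigma>. \<not> E t \<sigma>)"

lemma bisouslin_rel_not: "bisouslin_rel M E \<Longrightarrow> bisouslin_rel M (\<lambda>t \<sigma>. \<not> E t \<sigma>)"
  by (simp add: bisouslin_rel_def)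

lemma bisouslin_rel_ex:
  fixes E :: "nat \<Rightarrow> 'a \<Rightarrow> (nat \<Rightarrow> nat) \<Rightarrow> bool"
  shows "(\<And>j. bisouslin_rel M (E j)) \<Longrightarrow> bisouslin_rel M (\<lambda>t \<sigma>. \<exists>j. E j t \<sigma>)"
  unfolding bisouslin_rel_def using souslin_rel_ex[of M E] souslin_rel_all[of M "\<lambda>j t \<sigma>. \<not> E j t \<sigma>"]
  by simp

lemma bisouslin_rel_determined:
  assumes "\<And>\<sigma>. {t \<in> space M. E t \<sigma>} \<in> sets M"
    and "\<And>t \<sigma> \<sigma>'. E t \<sigma> \<Longrightarrow> (\<And>i. i < N \<Longrightarrow> \<sigma>' i = \<sigma> i) \<Longrightarrow> E t \<sigma>'"
  shows "bisouslin_rel M E"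
  unfolding bisouslin_rel_def
proof
  show "souslin_rel M E" using assms by (rule souslin_rel_determined)
  show "souslin_rel M (\<lambda>t \<sigma>. \<not> E t \<sigma>)"
  proof (rule souslin_rel_determined[of M _ N])
    show "{t \<in> space M. \<not> E t \<sigma>} \<in> sets M" for \<sigma>
      using assms(1) by measurable
    show "\<not> E t \<sigma>'" if "\<not> E t \<sigma>" "\<And>i. i < N \<Longrightarrow> \<sigma>' i = \<sigma> i" for t \<sigma> \<sigma>'
      using that assms(2)[of t \<sigma>' \<sigma>] by auto
  qed
qed

lemma bisouslin_rel_cong:
  assumes "\<And>t \<sigma>. t \<in> space M \<Longrightarrow> E t \<sigma> = E' t \<sigma>" and "bisouslin_rel M E"
  shows "bisouslin_rel M E'"
proof -
  have "souslin_rel M F'" if eq: "\<And>t \<sigma>. t \<in> space M \<Longrightarrow> F t \<sigma> = F' t \<sigma>" and F: "souslin_rel M F" for F F'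
    using F eq by (simp add: souslin_rel_def souslin_witness_def)
  from this[of E E'] this[of "\<lambda>t \<sigma>. \<not> E t \<sigma>" "\<lambda>t \<sigma>. \<not> E' t \<sigma>"] assms show ?thesis
    by (simp add: bisouslin_rel_def)
qed

lemma bisouslin_rel_sigma_sets:
  assumes "A \<in> sigma_sets Z G"
    and Z: "\<And>t \<sigma>. t \<in> space M \<Longrightarrow> g t \<sigma> \<in> Z"
    and G: "\<And>U. U \<in> G \<Longrightarrow> bisouslin_rel M (\<lambda>t \<sigma>. g t \<sigma> \<in> U)"
  shows "bisouslin_rel M (\<lambda>t \<sigma>. g t \<sigma> \<in> A)"
  using assms(1)
proof induction
  case (Basic a)
  then show ?case by (rule G)
next
  case Empty
  show ?case by (rule bisouslin_rel_determined[of _ _ 0]) auto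
next
  case (Compl a)
  show ?case
    by (rule bisouslin_rel_cong[OF _ bisouslin_rel_not[OF Compl.IH]]) (use Z in auto)
next
  case (Union a)
  show ?case
    by (rule bisouslin_rel_cong[OF _ bisouslin_rel_ex[OF Union.IH]]) auto
qed

section \<open>Projections of Borel sets in products of Polish spaces\<close>

text \<open>Every sequence is forced to be Cauchy by rejecting a candidate too far from the current
  point, so all branches are admissible codes. The value at \<open>n\<close> reads only
  \<open>b 0, ..., b n\<close>, which later gives continuity.\<close>

primrec settle :: "('a \<Rightarrow> 'a \<Rightarrow> real) \<Rightarrow> (nat \<Rightarrow> 'a) \<Rightarrow> nat \<Rightarrow> 'a" where
  "settle d b 0 = b 0"
| "settle d b (Suc n) = (if d (settle d b n) (b (Suc n)) < (1/2) ^ n then b (Suc n) else settle d b n)"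

lemma settle_cong: "(\<And>i. i \<le> n \<Longrightarrow> b' i = b i) \<Longrightarrow> settle d b' n = settle d b n"
  by (induction n) auto

context Metric_space
begin

lemma settle_in: "range b \<subseteq> M \<Longrightarrow> settle d b n \<in> M"
  by (induction n) auto

text \<open>The geometric tail is kept in exact telescoping form, since the plain bound
  \<open>2 * (1/2) ^ n\<close> would not pass through the induction.\<close>

lemma settle_dist:
  assumes b: "range b \<subseteq> M"
  shows "d (settle d b n) (settle d b (n + k)) \<le> 2 * (1/2) ^ n - 2 * (1/2) ^ (n + k)"
proof (induction k)
  case 0
  show ?case using settle_in[OF b] by simp
next
  case (Suc k)
  have "d (settle d b (n + k)) (settle d b (n + Suc k)) \<le> (1/2) ^ (n + k)"
    using settle_in[OF b] by simp
  moreover have "d (settle d b n) (settle d b (n + Suc k))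
      \<le> d (settle d b n) (settle d b (n + k)) + d (settle d b (n + k)) (settle d b (n + Suc k))"
    using settle_in[OF b] by (intro triangle)
  moreover have "(1/2 :: real) ^ (n + k) = 2 * (1/2) ^ (n + Suc k)" by simp
  ultimately show ?case using Suc by linarith
qed

lemma settle_dist_le:
  assumes b: "range b \<subseteq> M" and "n \<le> m"
  shows "d (settle d b n) (settle d b m) \<le> 2 * (1/2) ^ n"
proof -
  have "d (settle d b n) (settle d b m) \<le> 2 * (1/2) ^ n - 2 * (1/2) ^ m"
    using settle_dist[OF b, of n "m - n"] assms(2) by simp
  moreover have "0 \<le> (1/2 :: real) ^ m" by simp
  ultimately show ?thesis by linarith
qed

lemma settle_limit:
  assumes "mcomplete" and b: "range b \<subseteq> M"
  shows "\<exists>l\<in>M. \<forall>n. d (settle d b n) l \<le> 2 * (1/2) ^ n"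
proof -
  have "MCauchy (settle d b)"
    unfolding MCauchy_def
  proof (intro conjI allI impI)
    show "range (settle d b) \<subseteq> M" using settle_in[OF b] by auto
    fix e :: real assume "e > 0"
    then obtain N where N: "(1/2) ^ N < e / 4"
      using real_arch_pow_inv[of "e / 4" "1/2"] by auto
    show "\<exists>N. \<forall>n n'. N \<le> n \<longrightarrow> N \<le> n' \<longrightarrow> d (settle d b n) (settle d b n') < e"
    proof (intro exI allI impI)
      fix n n' assume n: "N \<le> n" "N \<le> n'"
      have "d (settle d b n) (settle d b n') \<le> d (settle d b n) (settle d b N) + d (settle d b N) (settle d b n')"
        using settle_in[OF b] by (intro triangle)
      then show "d (settle d b n) (settle d b n') < e"
        using settle_dist_le[OF b n(1)] settle_dist_le[OF b n(2)] N by (simp add: commute)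
    qed
  qed
  then obtain l where l: "limitin mtopology (settle d b) l sequentially"
    using assms(1) unfolding mcomplete_def by blast
  then have lM: "l \<in> M" by (simp add: limitin_metric)
  have "d (settle d b n) l \<le> 2 * (1/2) ^ n" for n
  proof (rule field_le_epsilon)
    fix e :: real assume "e > 0"
    with l obtain k where k: "k \<ge> n" "d (settle d b k) l < e"
      by (auto simp: limitin_metric eventually_sequentially dest!: spec[of _ e]) (metis nat_le_linear)
    have "d (settle d b n) l \<le> d (settle d b n) (settle d b k) + d (settle d b k) l"
      using settle_in[OF b] lM by (intro triangle)
    then show "d (settle d b n) l \<le> 2 * (1/2) ^ n + e"
      using settle_dist_le[OF b k(1)] k(2) by linarith
  qed
  with lM show ?thesis by blast
qed

text \<open>With the factor 1/4, consecutive points are closer than the acceptance threshold by the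
  triangle inequality, so none is rejected. Surjectivity of the parametrization rests on
  this.\<close>

lemma settle_close:
  assumes b: "range b \<subseteq> M" and x: "x \<in> M" and close: "\<And>n. d (b n) x < (1/2) ^ n / 4"
  shows "settle d b n = b n"
proof (cases n)
  case (Suc m)
  have "settle d b (Suc n) = b (Suc n)" for n
  proof (induction n)
    case 0
    have "d (b 0) (b 1) \<le> d (b 0) x + d x (b 1)" using b x by (intro triangle) auto
    then show ?case using close[of 0] close[of 1] by (simp add: commute)
  next
    case (Suc n)
    have "d (b (Suc n)) (b (Suc (Suc n))) \<le> d (b (Suc n)) x + d x (b (Suc (Suc n)))"
      using b x by (intro triangle) auto
    also have "\<dots> < (1/2) ^ Suc n"
      using close[of "Suc n"] close[of "Suc (Suc n)"] zero_less_power[of "1/2::real" n]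
      by (simp add: commute field_simps)
    finally show ?case using Suc by simp
  qed
  then show ?thesis using Suc by simp
qed simp

end

text \<open>
  The branch \<open>\<sigma>\<close> is sent to the limit of the points
  of a dense sequence with indices \<open>\<sigma> 0, \<sigma> 1, \<dots>\<close>, where points violating a fixed rate of convergence
  are skipped.
\<close>

lemma polish_topology_baire_image:
  assumes "polish_topology X" and "topspace X \<noteq> {}"
  shows "\<exists>\<phi> :: (nat \<Rightarrow> nat) \<Rightarrow> 'a. range \<phi> = topspace X \<and>
    (\<forall>U \<sigma>. openin X U \<longrightarrow> \<phi> \<sigma> \<in> U \<longrightarrow> (\<exists>n. \<forall>\<sigma>'. (\<forall>i<n. \<sigma>' i = \<sigma> i) \<longrightarrow> \<phi> \<sigma>' \<in> U))"
proof -
  obtain M d where M: "Metric_space M d" "Metric_space.mcomplete M d" "X = Metric_space.mtopology M d"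
    using assms(1) unfolding polish_topology_def completely_metrizable_space_def by blast
  interpret Metric_space M d by (rule M)
  have top: "topspace X = M" by (simp add: M(3))
  obtain C where C: "countable C" "C \<subseteq> M" "X closure_of C = M"
    using assms(1) unfolding polish_topology_def separable_space_def top by blast
  have "C \<noteq> {}" using C(3) assms(2) top by auto
  define a where "a = from_nat_into C"
  have a: "range a = C"
    unfolding a_def using C(1) \<open>C \<noteq> {}\<close> by (simp add: range_from_nat_into)
  have b: "range (\<lambda>n. a (\<sigma> n)) \<subseteq> M" for \<sigma> :: "nat \<Rightarrow> nat" using a C(2) by auto
  have dense: "\<exists>n. d (a n) x < r" if xr: "x \<in> M" "r > 0" for x r
  proof -
    have "x \<in> mtopology closure_of C" using C(3) xr M(3) by simp
    then obtain y where "y \<in> C" "y \<in> mball x r" using xr(2) unfolding metric_closure_of by blast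
    then show ?thesis using a by (auto simp: commute)
  qed
  let ?p = "\<lambda>\<sigma>. settle d (\<lambda>n. a (\<sigma> n))"
  have "\<exists>l\<in>M. \<forall>n. d (?p \<sigma> n) l \<le> 2 * (1/2) ^ n" for \<sigma>
    by (rule settle_limit[OF M(2) b])
  then obtain \<phi> where \<phi>: "\<And>\<sigma>. \<phi> \<sigma> \<in> M" "\<And>\<sigma> n. d (?p \<sigma> n) (\<phi> \<sigma>) \<le> 2 * (1/2) ^ n"
    by metis
  have "M \<subseteq> range \<phi>"
  proof
    fix x assume x: "x \<in> M"
    have "\<exists>m. d (a m) x < (1/2) ^ n / 4" for n by (rule dense[OF x]) simp
    then obtain \<sigma> where \<sigma>: "\<And>n. d (a (\<sigma> n)) x < (1/2) ^ n / 4" by metis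
    have "d x (\<phi> \<sigma>) \<le> 0 + e" if e: "e > 0" for e
    proof -
      obtain n where n: "(1/2) ^ n < e / 4"
        using real_arch_pow_inv[of "e / 4" "1/2"] e by auto
      have p: "?p \<sigma> n = a (\<sigma> n)" using settle_close[OF b[of \<sigma>] x \<sigma>] .
      have "d x (\<phi> \<sigma>) \<le> d x (a (\<sigma> n)) + d (a (\<sigma> n)) (\<phi> \<sigma>)"
        using x \<phi>(1) b[of \<sigma>] by (intro triangle) auto
      moreover have "d x (a (\<sigma> n)) < (1/2) ^ n / 4" using \<sigma>[of n] by (simp add: commute)
      moreover have "d (a (\<sigma> n)) (\<phi> \<sigma>) \<le> 2 * (1/2) ^ n" using \<phi>(2)[of \<sigma> n] p by simp
      moreover have "0 < (1/2 :: real) ^ n" by simp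
      ultimately show ?thesis using n by linarith
    qed
    then have "d x (\<phi> \<sigma>) \<le> 0" by (rule field_le_epsilon)
    then have "x = \<phi> \<sigma>" using x \<phi>(1) nonneg[of x "\<phi> \<sigma>"] by (metis antisym zero)
    then show "x \<in> range \<phi>" by blast
  qed
  moreover have "\<exists>n. \<forall>\<sigma>'. (\<forall>i<n. \<sigma>' i = \<sigma> i) \<longrightarrow> \<phi> \<sigma>' \<in> U" if U: "openin X U" "\<phi> \<sigma> \<in> U" for U \<sigma>
  proof -
    obtain r where r: "r > 0" "mball (\<phi> \<sigma>) r \<subseteq> U"
      using U unfolding M(3) openin_mtopology by blast
    obtain n where n: "(1/2) ^ n < r / 4"
      using real_arch_pow_inv[of "r / 4" "1/2"] r(1) by auto
    \<comment> \<open>Agreement up to \<open>Suc n\<close> fixes the settled point at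
      \<open>n\<close>. Both limits are within \<open>2 * (1/2) ^ n\<close> of it, hence the bound
      \<open>r / 4\<close> above.\<close>
    have "\<phi> \<sigma>' \<in> U" if "\<forall>i<Suc n. \<sigma>' i = \<sigma> i" for \<sigma>'
    proof -
      have p: "?p \<sigma>' n = ?p \<sigma> n" using that by (intro settle_cong) simp
      have "d (\<phi> \<sigma>) (\<phi> \<sigma>') \<le> d (\<phi> \<sigma>) (?p \<sigma> n) + d (?p \<sigma> n) (\<phi> \<sigma>')"
        using \<phi>(1) settle_in[OF b] by (intro triangle)
      then have "d (\<phi> \<sigma>) (\<phi> \<sigma>') < r"
        using \<phi>(2)[of \<sigma> n] \<phi>(2)[of \<sigma>' n] n p by (simp add: commute)
      then show ?thesis using r(2) \<phi>(1) by auto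
    qed
    then show ?thesis by blast
  qed
  ultimately show ?thesis using \<phi>(1) top by (intro exI[of _ \<phi>]) auto
qed

section \<open>From the parametrization to projections of Borel sets\<close>

lemma space_eq_topspace:
  assumes "sets N = borel_sets_of X"
  shows "space N = topspace X"
proof -
  have "{U. openin X U} \<subseteq> Pow (topspace X)" by (auto dest: openin_subset)
  then have "sets N = sets (sigma (topspace X) {U. openin X U})"
    using assms by (simp add: borel_sets_of_def)
  then show ?thesis by (auto dest: sets_eq_imp_space_eq simp: space_measure_of_conv)
qed

theorem sets_completion_PiM_projection:
  fixes X :: "nat \<Rightarrow> 'a topology" and P :: "nat \<Rightarrow> 'a measure"
  assumes K: "K \<subseteq> I"
    and X: "\<And>i. i \<in> I \<Longrightarrow> polish_topology (X i)"
    and P: "\<And>i. i \<in> I \<Longrightarrow> prob_space (P i)"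
    and sets: "\<And>i. i \<in> I \<Longrightarrow> sets (P i) = borel_sets_of (X i)"
    and E: "E \<in> sets (PiM I P)"
  shows "(\<lambda>x. restrict x K) ` E \<in> sets (completion (PiM K P))"
proof -
  let ?T = "PiM K P"
  interpret T: prob_space ?T using P K by (intro prob_space_PiM) auto
  note space = space_eq_topspace[OF sets]
  have "\<forall>i\<in>I. \<exists>\<phi> :: (nat \<Rightarrow> nat) \<Rightarrow> 'a. range \<phi> = topspace (X i) \<and>
    (\<forall>U \<sigma>. openin (X i) U \<longrightarrow> \<phi> \<sigma> \<in> U \<longrightarrow> (\<exists>n. \<forall>\<sigma>'. (\<forall>i<n. \<sigma>' i = \<sigma> i) \<longrightarrow> \<phi> \<sigma>' \<in> U))"
    using polish_topology_baire_image X space prob_space.not_empty[OF P] by metis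
  then obtain \<phi> :: "nat \<Rightarrow> (nat \<Rightarrow> nat) \<Rightarrow> 'a" where
    "\<forall>i\<in>I. range (\<phi> i) = topspace (X i) \<and>
    (\<forall>U \<sigma>. openin (X i) U \<longrightarrow> \<phi> i \<sigma> \<in> U \<longrightarrow> (\<exists>n. \<forall>\<sigma>'. (\<forall>j<n. \<sigma>' j = \<sigma> j) \<longrightarrow> \<phi> i \<sigma>' \<in> U))"
    by (elim bchoice[THEN exE])
  then have \<phi>: "\<And>i. i \<in> I \<Longrightarrow> range (\<phi> i) = topspace (X i)"
    and cont: "\<And>i U \<sigma>. i \<in> I \<Longrightarrow> openin (X i) U \<Longrightarrow> \<phi> i \<sigma> \<in> U \<Longrightarrow>
      \<exists>n. \<forall>\<sigma>'. (\<forall>j<n. \<sigma>' j = \<sigma> j) \<longrightarrow> \<phi> i \<sigma>' \<in> U"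
    by simp_all
  \<comment> \<open>A single branch codes a whole family: row \<open>i\<close> parametrizes
    coordinate \<open>i\<close>.\<close>
  define row where "row \<sigma> i j = \<sigma> (prod_encode (i, j))" for \<sigma> :: "nat \<Rightarrow> nat" and i j
  define g where "g t \<sigma> = (\<lambda>i\<in>I. if i \<in> K then t i else \<phi> i (row \<sigma> i))" for t \<sigma>
  have gsp: "g t \<sigma> \<in> (\<Pi>\<^sub>E i\<in>I. space (P i))" if "t \<in> space ?T" for t \<sigma>
  proof (intro PiE_I)
    fix i assume i: "i \<in> I"
    then have "\<phi> i (row \<sigma> i) \<in> space (P i)" using \<phi>[OF i] space[OF i] by blast
    moreover have "t i \<in> space (P i)" if "i \<in> K"
      using \<open>t \<in> space ?T\<close> that by (auto simp: space_PiM PiE_iff)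
    ultimately show "g t \<sigma> i \<in> space (P i)" using i by (simp add: g_def)
  qed (simp add: g_def)
  have coord: "bisouslin_rel ?T (\<lambda>t \<sigma>. g t \<sigma> i \<in> A)" if i: "i \<in> I" and A: "A \<in> sets (P i)" for i A
  proof (cases "i \<in> K")
    case True
    have eq: "g t \<sigma> i = t i" for t \<sigma> using True i by (simp add: g_def)
    show ?thesis
      unfolding eq by (rule bisouslin_rel_determined[of _ _ 0]) (use True A in measurable)
  next
    case False
    have eq: "g t \<sigma> i = \<phi> i (row \<sigma> i)" for t \<sigma> using False i by (simp add: g_def)
    have "A \<in> sigma_sets (topspace (X i)) {U. openin (X i) U}"
      using A sets[OF i] by (simp add: borel_sets_of_def)
    then have "bisouslin_rel ?T (\<lambda>t \<sigma>. \<phi> i (row \<sigma> i) \<in> A)"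
    proof (rule bisouslin_rel_sigma_sets)
      show "\<phi> i (row \<sigma> i) \<in> topspace (X i)" for \<sigma> using \<phi>[OF i] by auto
      fix U assume "U \<in> {U. openin (X i) U}"
      then have U: "openin (X i) U" by simp
      \<comment> \<open>By continuity, membership in an open set means that some finite prefix of
        the row forces it. For fixed \<open>n\<close> this does not involve \<open>t\<close> and
        reads finitely many entries of \<open>\<sigma>\<close>.\<close>
      have "bisouslin_rel ?T (\<lambda>t \<sigma>. \<forall>\<sigma>'. (\<forall>j<n. \<sigma>' j = row \<sigma> i j) \<longrightarrow> \<phi> i \<sigma>' \<in> U)" for n
      proof (rule bisouslin_rel_determined[of _ _ "Suc (\<Sum>j<n. prod_encode (i, j))"])
        fix \<sigma> \<sigma>' :: "nat \<Rightarrow> nat"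
        show "{t \<in> space ?T. \<forall>\<sigma>'. (\<forall>j<n. \<sigma>' j = row \<sigma> i j) \<longrightarrow> \<phi> i \<sigma>' \<in> U} \<in> sets ?T"
          by measurable
        assume *: "\<forall>\<sigma>'. (\<forall>j<n. \<sigma>' j = row \<sigma> i j) \<longrightarrow> \<phi> i \<sigma>' \<in> U"
          "\<And>k. k < Suc (\<Sum>j<n. prod_encode (i, j)) \<Longrightarrow> \<sigma>' k = \<sigma> k"
        have "row \<sigma>' i j = row \<sigma> i j" if "j < n" for j
        proof -
          have "prod_encode (i, j) \<le> (\<Sum>j<n. prod_encode (i, j))"
            using that by (intro member_le_sum) auto
          then show ?thesis unfolding row_def by (intro *(2)) simp
        qed
        then show "\<forall>\<tau>. (\<forall>j<n. \<tau> j = row \<sigma>' i j) \<longrightarrow> \<phi> i \<tau> \<in> U" using *(1) by simp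
      qed
      then have "bisouslin_rel ?T (\<lambda>t \<sigma>. \<exists>n. \<forall>\<sigma>'. (\<forall>j<n. \<sigma>' j = row \<sigma> i j) \<longrightarrow> \<phi> i \<sigma>' \<in> U)"
        by (rule bisouslin_rel_ex)
      then show "bisouslin_rel ?T (\<lambda>t \<sigma>. \<phi> i (row \<sigma> i) \<in> U)"
        by (rule bisouslin_rel_cong[rotated]) (use cont[OF i U] in blast)
    qed
    then show ?thesis by (simp only: eq)
  qed
  have "bisouslin_rel ?T (\<lambda>t \<sigma>. g t \<sigma> \<in> E)"
    using E unfolding sets_PiM_single
  proof (rule bisouslin_rel_sigma_sets[OF _ gsp])
    fix U assume "U \<in> {{f \<in> \<Pi>\<^sub>E i\<in>I. space (P i). f i \<in> A} |i A. i \<in> I \<and> A \<in> sets (P i)}"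
    then obtain i A where U: "U = {f \<in> \<Pi>\<^sub>E i\<in>I. space (P i). f i \<in> A}" "i \<in> I" "A \<in> sets (P i)" by blast
    show "bisouslin_rel ?T (\<lambda>t \<sigma>. g t \<sigma> \<in> U)"
      by (rule bisouslin_rel_cong[OF _ coord[OF U(2,3)]]) (use gsp in \<open>auto simp: U(1)\<close>)
  qed
  then have "{t \<in> space ?T. \<exists>\<sigma>. g t \<sigma> \<in> E} \<in> sets (completion ?T)"
    unfolding bisouslin_rel_def by (intro T.souslin_rel_projection) simp
  also have "{t \<in> space ?T. \<exists>\<sigma>. g t \<sigma> \<in> E} = (\<lambda>x. restrict x K) ` E"
  proof (intro equalityI subsetI)
    fix t assume "t \<in> {t \<in> space ?T. \<exists>\<sigma>. g t \<sigma> \<in> E}"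
    then obtain \<sigma> where t: "t \<in> space ?T" "g t \<sigma> \<in> E" by blast
    have "t = restrict (g t \<sigma>) K"
    proof
      fix i
      show "t i = restrict (g t \<sigma>) K i"
        using K PiE_arb[OF t(1)[unfolded space_PiM], of i] by (cases "i \<in> K") (auto simp: g_def)
    qed
    with t(2) show "t \<in> (\<lambda>x. restrict x K) ` E" by blast
  next
    fix t assume "t \<in> (\<lambda>x. restrict x K) ` E"
    then obtain x where x: "x \<in> E" "t = restrict x K" by blast
    have xs: "x \<in> (\<Pi>\<^sub>E i\<in>I. space (P i))"
      using sets.sets_into_space[OF E] x(1) by (auto simp: space_PiM)
    have "\<forall>i\<in>I. \<exists>\<sigma>. \<phi> i \<sigma> = x i"
      using xs \<phi> space by (metis PiE_mem imageE)
    then obtain s where s: "\<And>i. i \<in> I \<Longrightarrow> \<phi> i (s i) = x i" by metis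
    define \<sigma> where "\<sigma> k = (case prod_decode k of (i, j) \<Rightarrow> s i j)" for k
    have "row \<sigma> i = s i" for i by (auto simp: row_def \<sigma>_def)
    then have "g t \<sigma> i = x i" for i
      using s[of i] PiE_arb[OF xs, of i] by (simp add: g_def x(2))
    then have "g t \<sigma> = x" by (rule ext)
    moreover have "t \<in> space ?T"
      using xs K by (auto simp: x(2) space_PiM)
    ultimately show "t \<in> {t \<in> space ?T. \<exists>\<sigma>. g t \<sigma> \<in> E}" using x(1) by blast
  qed
  finally show ?thesis .
qed

section \<open>The box inequality\<close>

text \<open>The event is the preimage under restriction to \<open>K\<close> of the complement of a
  projection. Splitting that complement into a measurable and a negligible part before pulling back
  makes \<open>C\<close> exactly \<open>K\<close>-determined; the null set stays null because
  restriction has law \<open>PiM K P\<close>.\<close>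

lemma cylinder_interior_approx:
  fixes X :: "nat \<Rightarrow> 'a topology" and P :: "nat \<Rightarrow> 'a measure"
  assumes K: "K \<subseteq> I"
    and X: "\<And>i. i \<in> I \<Longrightarrow> polish_topology (X i)"
    and P: "\<And>i. i \<in> I \<Longrightarrow> prob_space (P i)"
    and sets: "\<And>i. i \<in> I \<Longrightarrow> sets (P i) = borel_sets_of (X i)"
    and E: "E \<in> sets (PiM I P)"
  defines "S \<equiv> space (PiM I P)"
  shows "\<exists>C N. C \<in> sets (PiM I P) \<and> N \<in> null_sets (PiM I P) \<and>
    C \<subseteq> {x \<in> S. cylinder S K x \<subseteq> E} \<and> {x \<in> S. cylinder S K x \<subseteq> E} \<subseteq> C \<union> N \<and>
    (\<forall>x\<in>C. \<forall>y\<in>S. (\<forall>i\<in>K. y i = x i) \<longrightarrow> y \<in> C)"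
proof -
  let ?M = "PiM I P" and ?T = "PiM K P"
  let ?F = "(\<lambda>x. restrict x K) ` (S - E)"
  have res: "(\<lambda>x. restrict x K) \<in> ?M \<rightarrow>\<^sub>M ?T"
    using K by (rule measurable_restrict_subset)
  have "S - E \<in> sets ?M" using E by (auto simp: S_def)
  then have "?F \<in> sets (completion ?T)"
    using sets_completion_PiM_projection[OF K X P sets] by simp
  then have "space ?T - ?F \<in> sets (completion ?T)"
    using sets.compl_sets[of ?F "completion ?T"] by simp
  then obtain C N' N where C: "C \<in> sets ?T" and N: "N \<in> null_sets ?T" "N' \<subseteq> N"
    and eq: "space ?T - ?F = C \<union> N'"
    by (rule sets_completionE) blast
  have in_F: "restrict x K \<in> ?F \<longleftrightarrow> \<not> cylinder S K x \<subseteq> E" if "x \<in> S" for x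
  proof -
    have "restrict x K = restrict y K \<longleftrightarrow> (\<forall>i\<in>K. y i = x i)" for y
      by (auto simp: fun_eq_iff restrict_def)
    then show ?thesis unfolding cylinder_def by (auto simp: image_iff)
  qed
  have interior: "{x \<in> S. cylinder S K x \<subseteq> E} = {x \<in> S. restrict x K \<in> C \<union> N'}"
    using in_F measurable_space[OF res] unfolding eq[symmetric] by (auto simp: S_def)
  have null: "{x \<in> S. restrict x K \<in> N} \<in> null_sets ?M"
  proof -
    have "distr ?M (\<Pi>\<^sub>M i\<in>K. P (id i)) (\<lambda>\<omega>. \<lambda>i\<in>K. \<omega> (id i)) = (\<Pi>\<^sub>M i\<in>K. P (id i))"
      using P K by (intro distr_PiM_reindex) auto
    then have "distr ?M ?T (\<lambda>x. restrict x K) = ?T"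
      by (simp add: restrict_def)
    then have "N \<in> null_sets (distr ?M ?T (\<lambda>x. restrict x K))" using N(1) by simp
    then have "(\<lambda>x. restrict x K) -` N \<inter> space ?M \<in> null_sets ?M"
      by (simp add: null_sets_distr_iff[OF res])
    also have "(\<lambda>x. restrict x K) -` N \<inter> space ?M = {x \<in> S. restrict x K \<in> N}"
      by (auto simp: S_def)
    finally show ?thesis .
  qed
  have meas: "{x \<in> S. restrict x K \<in> C} \<in> sets ?M"
    using measurable_sets[OF res C] by (simp add: S_def vimage_def Int_def conj_commute)
  have det: "y \<in> {x \<in> S. restrict x K \<in> C}"
    if "x \<in> {x \<in> S. restrict x K \<in> C}" "y \<in> S" "\<forall>i\<in>K. y i = x i" for x y
  proof -
    have "restrict y K = restrict x K" using that(3) by (auto simp: restrict_def)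
    then show ?thesis using that by simp
  qed
  show ?thesis
    by (rule exI[of _ "{x \<in> S. restrict x K \<in> C}"], rule exI[of _ "{x \<in> S. restrict x K \<in> N}"])
      (use meas null det interior N(2) in auto)
qed

theorem proposition3p2:
  fixes n :: nat
    and X :: "nat \<Rightarrow> 'a topology"
    and P :: "nat \<Rightarrow> 'a measure"
    and A B :: "(nat \<Rightarrow> 'a) set"
  defines "S \<equiv> (\<Pi>\<^sub>E i\<in>{1..n}. topspace (X i))"
    and "M \<equiv> (\<Pi>\<^sub>M i\<in>{1..n}. P i)"
  assumes "n \<ge> 1"
    and "\<And>i. i \<in> {1..n} \<Longrightarrow> polish_topology (X i)"
    and "\<And>i. i \<in> {1..n} \<Longrightarrow> prob_space (P i)"
    and "\<And>i. i \<in> {1..n} \<Longrightarrow> sets (P i) = borel_sets_of (X i)"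
    and "A \<in> sets M" and "B \<in> sets M"
  shows "cyl_core n S A \<in> sets (completion M)
    \<and> cyl_core n S B \<in> sets (completion M)
    \<and> disjoint_box n S A B \<in> sets (completion M)
    \<and> (A \<noteq> S \<and> B \<noteq> S \<longrightarrow>
        measure (completion M) (disjoint_box n S A B)
          \<le> measure (completion M) (cyl_core n S A) * measure (completion M) (cyl_core n S B))"
proof -
  let ?I = "{1..n}" and ?H = "completion M"
  have S: "S = space M"
    unfolding S_def M_def space_PiM using assms(6) by (intro PiE_cong) (simp add: space_eq_topspace)
  interpret M: prob_space M unfolding M_def using assms(5) by (intro prob_space_PiM)
  interpret H: finite_measure ?H
    by (rule finite_measureI) (simp add: M.emeasure_eq_measure)
  define cyl_int where "cyl_int E K = {x \<in> S. cylinder S K x \<subseteq> E}" for E K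
  \<comment> \<open>A cylinder equals the cylinder of any of its points, so the union over all base
    points collapses to a finite union over proper index sets.\<close>
  have core: "cyl_core n S E = (\<Union>K\<in>Pow ?I - {?I}. cyl_int E K)" for E
  proof -
    have card: "card K \<le> n - 1 \<longleftrightarrow> K \<noteq> ?I" if "K \<subseteq> ?I" for K
    proof (cases "K = ?I")
      case False
      then have "card K < card ?I" using that by (intro psubset_card_mono) auto
      then show ?thesis using False by simp
    qed (use assms(3) in simp)
    show ?thesis
    proof (intro equalityI subsetI)
      fix y assume "y \<in> cyl_core n S E"
      then obtain x K where K: "K \<subseteq> ?I" "card K \<le> n - 1" "cylinder S K x \<subseteq> E" "y \<in> cylinder S K x"
        unfolding cyl_core_def by blast
      have "cylinder S K y = cylinder S K x" "y \<in> S"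
        using K(4) by (auto simp: cylinder_def)
      then have "y \<in> cyl_int E K" using K(3) by (simp add: cyl_int_def)
      then show "y \<in> (\<Union>K\<in>Pow ?I - {?I}. cyl_int E K)" using K(1,2) card by blast
    next
      fix y assume "y \<in> (\<Union>K\<in>Pow ?I - {?I}. cyl_int E K)"
      then obtain K where K: "K \<subseteq> ?I" "K \<noteq> ?I" "y \<in> S" "cylinder S K y \<subseteq> E"
        unfolding cyl_int_def by blast
      moreover have "y \<in> cylinder S K y" using K(3) by (simp add: cylinder_def)
      ultimately show "y \<in> cyl_core n S E"
        unfolding cyl_core_def using card[OF K(1)] by blast
    qed
  qed
  have box: "disjoint_box n S A B = (\<Union>K\<in>Pow ?I. \<Union>L\<in>Pow (?I - K). cyl_int A K \<inter> cyl_int B L)"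
  proof (intro equalityI subsetI)
    fix x assume "x \<in> disjoint_box n S A B"
    then obtain K L where "K \<subseteq> ?I" "L \<subseteq> ?I" "K \<inter> L = {}" "x \<in> cyl_int A K \<inter> cyl_int B L"
      unfolding disjoint_box_def cyl_int_def by blast
    then show "x \<in> (\<Union>K\<in>Pow ?I. \<Union>L\<in>Pow (?I - K). cyl_int A K \<inter> cyl_int B L)"
      by (intro UN_I[of K] UN_I[of L]) auto
  next
    fix x assume "x \<in> (\<Union>K\<in>Pow ?I. \<Union>L\<in>Pow (?I - K). cyl_int A K \<inter> cyl_int B L)"
    then obtain K L where "K \<subseteq> ?I" "L \<subseteq> ?I - K" "x \<in> cyl_int A K" "x \<in> cyl_int B L" by blast
    then show "x \<in> disjoint_box n S A B"
      unfolding disjoint_box_def cyl_int_def by (intro CollectI conjI exI[of _ K] exI[of _ L]) auto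
  qed
  define approx where "approx E K C N \<longleftrightarrow> C \<in> sets M \<and> N \<in> null_sets M \<and> C \<subseteq> cyl_int E K \<and> cyl_int E K \<subseteq> C \<union> N \<and>
    (\<forall>x\<in>C. \<forall>y\<in>S. (\<forall>i\<in>K. y i = x i) \<longrightarrow> y \<in> C)" for E K C N
  have ex: "\<exists>C N. approx E K C N" if "E \<in> sets M" "K \<subseteq> ?I" for E K
    using cylinder_interior_approx[OF that(2) assms(4-6) that(1)[unfolded M_def]]
    unfolding approx_def cyl_int_def S M_def .
  have "\<forall>K. \<exists>C N. K \<subseteq> ?I \<longrightarrow> approx A K C N"
    using ex[OF assms(7)] by blast
  then obtain C NC where "\<forall>K. K \<subseteq> ?I \<longrightarrow> approx A K (C K) (NC K)" by metis
  then have C: "C K \<in> sets M" "NC K \<in> null_sets M" "C K \<subseteq> cyl_int A K" "cyl_int A K \<subseteq> C K \<union> NC K"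
      "\<And>x y. x \<in> C K \<Longrightarrow> y \<in> S \<Longrightarrow> (\<And>i. i \<in> K \<Longrightarrow> y i = x i) \<Longrightarrow> y \<in> C K" if "K \<subseteq> ?I" for K
    using that by (simp_all add: approx_def)
  have "\<forall>K. \<exists>C N. K \<subseteq> ?I \<longrightarrow> approx B K C N"
    using ex[OF assms(8)] by blast
  then obtain D ND where "\<forall>K. K \<subseteq> ?I \<longrightarrow> approx B K (D K) (ND K)" by metis
  then have D: "D K \<in> sets M" "ND K \<in> null_sets M" "D K \<subseteq> cyl_int B K" "cyl_int B K \<subseteq> D K \<union> ND K"
      "\<And>x y. x \<in> D K \<Longrightarrow> y \<in> S \<Longrightarrow> (\<And>i. i \<in> K \<Longrightarrow> y i = x i) \<Longrightarrow> y \<in> D K" if "K \<subseteq> ?I" for K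
    using that by (simp_all add: approx_def)
  have cyl_int_sets: "cyl_int E K \<in> sets ?H" if "E \<in> sets M" "K \<subseteq> ?I" for E K
  proof -
    from ex[OF that] obtain C N where "approx E K C N" by blast
    then have "C \<in> sets M" "N \<in> null_sets M" "C \<subseteq> cyl_int E K" "cyl_int E K \<subseteq> C \<union> N"
      by (simp_all add: approx_def)
    then show ?thesis
      by (intro sets_completionI[of "cyl_int E K" C "cyl_int E K - C" N]) auto
  qed
  have core_sets: "cyl_core n S E \<in> sets ?H" if "E \<in> sets M" for E
    unfolding core using cyl_int_sets[OF that] by (intro sets.finite_UN) auto
  have box_sets: "disjoint_box n S A B \<in> sets ?H"
    unfolding box using cyl_int_sets assms(7,8)
    by (intro sets.finite_UN sets.Int) (auto simp: finite_subset)
  have "measure ?H (disjoint_box n S A B) \<le> measure ?H (cyl_core n S A) * measure ?H (cyl_core n S B)"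
    if ne: "A \<noteq> S" "B \<noteq> S"
  proof -
    have cyl_int_empty: "cyl_int A {} = {}" "cyl_int B {} = {}"
      using ne sets.sets_into_space[OF assms(7)] sets.sets_into_space[OF assms(8)]
      by (auto simp: cyl_int_def cylinder_def S)
    define C' where "C' K = (if K = ?I then {} else C K)" for K
    define D' where "D' K = (if K = ?I then {} else D K)" for K
    \<comment> \<open>\<open>reimer_PiM\<close> asks for a probability measure at every index;
      outside the range \<open>P 1\<close> is a legitimate filler since
      \<open>n \<ge> 1\<close>.\<close>
    define P' where "P' i = (if i \<in> ?I then P i else P 1)" for i
    have P': "prob_space (P' i)" for i using assms(3,5) by (auto simp: P'_def)
    have M: "M = PiM ?I P'" unfolding M_def by (intro PiM_cong) (auto simp: P'_def)
    txt \<open>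
      The core admits no cylinders over the full index set. Discarding these is harmless on the left as well:
      \<open>K = {1..n}\<close> forces \<open>L = {}\<close>, and no cylinder over \<open>{}\<close> is contained in a proper subset.
    \<close>
    let ?Box = "\<Union>K\<in>Pow ?I. \<Union>L\<in>Pow (?I - K). C' K \<inter> D' L"
    let ?N = "(\<Union>K\<in>Pow ?I. NC K) \<union> (\<Union>K\<in>Pow ?I. ND K)"
    have C's: "C' K \<in> sets M" and D's: "D' K \<in> sets M" if "K \<subseteq> ?I" for K
      using C(1)[OF that] D(1)[OF that] by (auto simp: C'_def D'_def)
    have N: "?N \<in> null_sets M"
      using C(2) D(2) by (intro null_sets.Un null_sets_UN' countable_finite) auto
    have Box: "?Box \<in> sets M"
      using C's D's by (intro sets.finite_UN sets.Int) auto
    have "disjoint_box n S A B \<subseteq> ?Box \<union> ?N"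
    proof
      fix x assume "x \<in> disjoint_box n S A B"
      then obtain K L where KL: "K \<subseteq> ?I" "L \<subseteq> ?I - K" "x \<in> cyl_int A K" "x \<in> cyl_int B L"
        unfolding box by blast
      have "K \<noteq> {}" "L \<noteq> {}" using KL(3,4) cyl_int_empty by auto
      then have "K \<noteq> ?I" "L \<noteq> ?I" using KL(1,2) by auto
      moreover have "L \<subseteq> ?I" using KL(2) by blast
      moreover have "x \<in> C K \<union> NC K" using C(4)[OF KL(1)] KL(3) by blast
      moreover have "x \<in> D L \<union> ND L" using D(4)[OF \<open>L \<subseteq> ?I\<close>] KL(4) by blast
      ultimately show "x \<in> ?Box \<union> ?N" using KL(1,2) by (auto simp: C'_def D'_def)
    qed
    then have "measure ?H (disjoint_box n S A B) \<le> measure ?H (?Box \<union> ?N)"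
      using Box N by (intro H.finite_measure_mono) auto
    also have "\<dots> = measure M (?Box \<union> ?N)"
      using Box N by (intro measure_completion) auto
    also have "\<dots> = measure M ?Box"
      by (rule measure_Un_null_set[OF Box N])
    also have "\<dots> \<le> measure M (\<Union>K\<in>Pow ?I. C' K) * measure M (\<Union>L\<in>Pow ?I. D' L)"
      unfolding M
    proof (rule reimer_PiM)
      show "C' K \<in> sets (PiM ?I P')" "D' K \<in> sets (PiM ?I P')" if "K \<subseteq> ?I" for K
        using C's[OF that] D's[OF that] by (simp_all add: M)
      show "y \<in> C' K" if "K \<subseteq> ?I" "x \<in> C' K" "y \<in> space (PiM ?I P')" "\<And>i. i \<in> K \<Longrightarrow> y i = x i" for K x y
      proof -
        have "y \<in> S" using that(3) by (simp only: S M)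
        moreover have "K \<noteq> ?I" "x \<in> C K" using that(2) unfolding C'_def by (metis empty_iff)+
        ultimately have "y \<in> C K" using C(5)[OF that(1)] that(4) by blast
        with \<open>K \<noteq> ?I\<close> show ?thesis by (simp only: C'_def if_False)
      qed
      show "y \<in> D' K" if "K \<subseteq> ?I" "x \<in> D' K" "y \<in> space (PiM ?I P')" "\<And>i. i \<in> K \<Longrightarrow> y i = x i" for K x y
      proof -
        have "y \<in> S" using that(3) by (simp only: S M)
        moreover have "K \<noteq> ?I" "x \<in> D K" using that(2) unfolding D'_def by (metis empty_iff)+
        ultimately have "y \<in> D K" using D(5)[OF that(1)] that(4) by blast
        with \<open>K \<noteq> ?I\<close> show ?thesis by (simp only: D'_def if_False)
      qed
    qed (use P' in auto)
    also have "\<dots> \<le> measure ?H (cyl_core n S A) * measure ?H (cyl_core n S B)"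
    proof (rule mult_mono)
      have U: "(\<Union>K\<in>Pow ?I. C' K) \<in> sets M" "(\<Union>K\<in>Pow ?I. D' K) \<in> sets M"
        using C's D's by (auto intro!: sets.finite_UN)
      have "C' K \<subseteq> cyl_core n S A" "D' K \<subseteq> cyl_core n S B" if "K \<subseteq> ?I" for K
        using C(3)[OF that] D(3)[OF that] that unfolding core C'_def D'_def
        by (cases "K = ?I"; simp; blast)+
      then have "(\<Union>K\<in>Pow ?I. C' K) \<subseteq> cyl_core n S A" "(\<Union>K\<in>Pow ?I. D' K) \<subseteq> cyl_core n S B"
        by (intro UN_least, simp only: Pow_iff)+
      from H.finite_measure_mono[OF this(1) core_sets[OF assms(7)]]
        H.finite_measure_mono[OF this(2) core_sets[OF assms(8)]]
      show "measure M (\<Union>K\<in>Pow ?I. C' K) \<le> measure ?H (cyl_core n S A)"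
        "measure M (\<Union>K\<in>Pow ?I. D' K) \<le> measure ?H (cyl_core n S B)"
        using U by simp_all
    qed auto
    finally show ?thesis .
  qed
  then show ?thesis using core_sets assms(7,8) box_sets by blast
qed

end
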